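(* Let $\Gamma$ be an embedded network with Hamiltonian $\mathcal H=\{H_\gamma\}_{\gamma\in\mathcal E}$ as in the context, let $c$ be its critical value and $\mathcal A_\Gamma$ its Aubry set. Let $\Gamma'$ be a closed subset of $\Gamma$ containing $\mathcal A_\Gamma$, let $v:\Gamma\to\mathbb R$ be a continuous supersolution to $\mathcal H(x,Du)=c$ in $\Gamma\setminus\Gamma'$, and let $w:\Gamma\to\mathbb R$ be a subsolution to $\mathcal H(x,Du)=c$ on $\Gamma$. If $v\ge w$ on $\Gamma'$, then $v\ge w$ on $\Gamma$.
   Context: **Network.** Fix a dimension $N$. $\mathcal E$ is a finite collection of arcs, i.e. regular ($C^1$ on $[0,1]$, with one-sided derivatives at the endpoints, and non-vanishing derivative) simple oriented curves $\gamma:[0,1]\to\mathbb R^N$ (loops, $\gamma(0)=\gamma(1)$, are allowed), such that for each $\gamma\in\mathcal E$ the inverse arc $\widetilde\gamma(s):=\gamma(1-s)$ also belongs to $\mathcal E$, and $\gamma((0,1))\cap\gamma'([0,1])=\emptyset$ whenever $\gamma'\in\mathcal E$, $\gamma'\ne\gamma,\widetilde\gamma$. The embedded network is $\Gamma=\bigcup_{\gamma\in\mathcal E}\gamma([0,1])\subset\mathbb R^N$. The set $\mathbf V$ of vertices consists of all initial and terminal points of arcs. $\Gamma$ is assumed connected: any two vertices are linked by a finite concatenation of arcs. For $x\in\mathbf V$, $\Gamma_x:=\{\gamma\in\mathcal E:\gamma(1)=x\}$. **Hamiltonian.** $\mathcal H=\{H_\gamma\}_{\gamma\in\mathcal E}$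 with $H_\gamma:[0,1]\times\mathbb R\to\mathbb R$ satisfying $H_{\widetilde\gamma}(s,\mu)=H_\gamma(1-s,-\mu)$; otherwise the $H_\gamma$ are unrelated. Each $H_\gamma$ is continuous in both arguments, coercive in $\mu$, and strictly quasiconvex in $\mu$: $H_\gamma(s,\rho\mu+(1-\rho)\mu')<\max\{H_\gamma(s,\mu),H_\gamma(s,\mu')\}$ for all $s\in[0,1]$, $\mu\ne\mu'$ in $\mathbb R$, $\rho\in(0,1)$. **Equation and solutions.** For $a\in\mathbb R$, $\mathcal H(x,Du)=a$ on $\Gamma$ denotes the family of equations $H_\gamma(s,\partial U)=a$ on $[0,1]$, $\gamma\in\mathcal E$, understood in the viscosity sense. A continuous $w:\Gamma\to\mathbb R$ is a subsolution if $w\circ\gamma$ is a viscosity subsolution of $H_\gamma(s,\partial U)=a$ in $(0,1)$ for every $\gamma\in\mathcal E$. A continuous $v:\Gamma\to\mathbb R$ is a supersolution if (1) $v\circ\gamma$ is a viscosity supersolution of $H_\gamma(s,\partial U)=a$ in $(0,1)$ for every $\gamma\in\mathcal E$, and (2) for every vertex $x$ there is at least one arc $\gamma\in\Gamma_x$ such that $H_\gamma(1,\partial\varphi(1))\ge a$ for every constrained $C^1$ subtangent $\varphi$ to $v\circ\gamma$ at $1$, i.e. every $C^1$ function $\varphi$ such that $1$ is a minimizer of $v\circ\gamma-\varphi$ in a neighborhood of $1$ intersected with $[0,1]$. A solution is both a sub- and a supersolution. Being a supersolution (solution) in a subset of $\Gamma$ means that the corresponding pointwise conditions hold at all points of that subset: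 the viscosity test at $s$ for $x=\gamma(s)$, $s\in(0,1)$, in the subset, and condition (2) at the vertices in the subset. **Critical value.** $a_\gamma:=\max_{s\in[0,1]}\min_{\mu\in\mathbb R}H_\gamma(s,\mu)$, $a_0:=\max_{\gamma\in\mathcal E}a_\gamma$, and $c:=\inf\{a\ge a_0:\mathcal H(x,Du)=a\text{ admits subsolutions}\}$ (finite). **Support functions.** $\sigma^+_{\gamma,a}(s):=\max\{\mu:H_\gamma(s,\mu)=a\}$, $\sigma^-_{\gamma,a}(s):=\min\{\mu:H_\gamma(s,\mu)=a\}$ (with values $-\infty$ and $+\infty$, respectively, if the set is empty). For $x\in\Gamma$, the tangent space $T_x\Gamma$ is the set of $q=\lambda\dot\gamma(s)$ with $\gamma\in\mathcal E$, $\gamma(s)=x$, $\lambda\in\mathbb R$; $T\Gamma$ is the disjoint union of the $T_x\Gamma$. The map $\sigma_a$ on $T\Gamma$ is: if $x=\gamma(s)$, $s\in(0,1)$, $\sigma_a(x,q):=\max\{\mu\,\frac{q\cdot\dot\gamma(s)}{|\dot\gamma(s)|^2}:H_\gamma(s,\mu)=a\}$ ($-\infty$ if the set is empty); if $x\in\mathbf V$, $q\ne0$, $\sigma_a(x,q):=\min\max\{\mu\,\frac{q\cdot\dot\gamma(1)}{|\dot\gamma(1)|^2}:H_\gamma(1,\mu)=a\}$, the minimum over $\gamma\in\Gamma_x$ with $\dot\gamma(1)$ parallel to $q$ ($-\infty$ if the set is empty for some such $\gamma$); if $x\in\mathbf V$, $\sigma_a(x,0):=0$. **Curves.** A curve in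 $\Gamma$ is an absolutely continuous map $\xi:[0,T]\to\Gamma$; it is closed if $\xi(0)=\xi(T)$; a closed simple curve is one injective apart from $\xi(0)=\xi(T)$ (in particular nonconstant). **Aubry set.** $\mathcal A_\Gamma$ is the closed set made up of (i) the $x\in\Gamma$ lying on a closed simple curve $\xi:[0,T]\to\Gamma$ with $\int_0^T\sigma_c(\xi,\dot\xi)\,d\tau=0$; (ii) the $x=\gamma(s)$, $\gamma\in\mathcal E$, $s\in[0,1]$, such that $\sigma^+_{\gamma,c}(s)=\sigma^-_{\gamma,c}(s)$. *)

theory Defs
  imports "HOL-Analysis.Analysis"
begin

section \<open>Embedded networks\<close>

text \<open>An arc is a function on the reals of which only the restriction to [0,1] matters.  At 0 and 1
  its derivative is one-sided.\<close>

definition arc_velocity :: "(real \<Rightarrow> 'a::euclidean_space) \<Rightarrow> real \<Rightarrow> 'a" where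
  "arc_velocity \<gamma> s = vector_derivative \<gamma> (at s within {0..1})"

definition regular_simple_arc :: "(real \<Rightarrow> 'a::euclidean_space) \<Rightarrow> bool" where
  "regular_simple_arc \<gamma> \<longleftrightarrow>
     simple_path \<gamma> \<and>
     (\<forall>s\<in>{0..1}. \<gamma> differentiable (at s within {0..1})) \<and>
     continuous_on {0..1} (arc_velocity \<gamma>) \<and>
     (\<forall>s\<in>{0..1}. arc_velocity \<gamma> s \<noteq> 0)"

definition network_space :: "(real \<Rightarrow> 'a::euclidean_space) set \<Rightarrow> 'a set" where
  "network_space E = (\<Union>\<gamma>\<in>E. path_image \<gamma>)"

definition vertices :: "(real \<Rightarrow> 'a::euclidean_space) set \<Rightarrow> 'a set" where
  "vertices E = pathstart ` E \<union> pathfinish ` E"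

definition arcs_into :: "(real \<Rightarrow> 'a::euclidean_space) set \<Rightarrow> 'a \<Rightarrow> (real \<Rightarrow> 'a) set" where
  "arcs_into E x = {\<gamma>\<in>E. pathfinish \<gamma> = x}"

definition embedded_network :: "(real \<Rightarrow> 'a::euclidean_space) set \<Rightarrow> bool" where
  "embedded_network E \<longleftrightarrow>
     finite E \<and> E \<noteq> {} \<and>
     (\<forall>\<gamma>\<in>E. regular_simple_arc \<gamma>) \<and>
     (\<forall>\<gamma>\<in>E. reversepath \<gamma> \<in> E) \<and>
     (\<forall>\<gamma>\<in>E. \<forall>\<gamma>'\<in>E. \<gamma>' \<noteq> \<gamma> \<and> \<gamma>' \<noteq> reversepath \<gamma> \<longrightarrow> \<gamma> ` {0<..<1} \<inter> \<gamma>' ` {0..1} = {}) \<and>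
     (\<forall>x\<in>vertices E. \<forall>y\<in>vertices E. (x, y) \<in> {(pathstart \<gamma>, pathfinish \<gamma>) | \<gamma>. \<gamma> \<in> E}\<^sup>*)"

section \<open>Hamiltonians, sub- and supersolutions\<close>

text \<open>Coercivity is required at each fixed s; with continuity and quasiconvexity it is then
  uniform in s.\<close>

definition network_hamiltonian ::
  "(real \<Rightarrow> 'a::euclidean_space) set \<Rightarrow> ((real \<Rightarrow> 'a) \<Rightarrow> real \<Rightarrow> real \<Rightarrow> real) \<Rightarrow> bool" where
  "network_hamiltonian E H \<longleftrightarrow>
     (\<forall>\<gamma>\<in>E. \<forall>s\<in>{0..1}. \<forall>\<mu>. H (reversepath \<gamma>) s \<mu> = H \<gamma> (1 - s) (- \<mu>)) \<and>
     (\<forall>\<gamma>\<in>E. continuous_on ({0..1} \<times> UNIV) (\<lambda>(s, \<mu>). H \<gamma> s \<mu>)) \<and>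
     (\<forall>\<gamma>\<in>E. \<forall>s\<in>{0..1}. filterlim (H \<gamma> s) at_top at_infinity) \<and>
     (\<forall>\<gamma>\<in>E. \<forall>s\<in>{0..1}. \<forall>\<mu> \<mu>' \<rho>. \<mu> \<noteq> \<mu>' \<and> 0 < \<rho> \<and> \<rho> < 1 \<longrightarrow>
        H \<gamma> s (\<rho> * \<mu> + (1 - \<rho>) * \<mu>') < max (H \<gamma> s \<mu>) (H \<gamma> s \<mu>'))"

text \<open>The neighbourhoods are relative to [0,1]: for s in the open interval (0,1) these are the usual
  viscosity test functions, for s = 1 they are the constrained ones.\<close>

definition supertangent :: "(real \<Rightarrow> real) \<Rightarrow> (real \<Rightarrow> real) \<Rightarrow> real \<Rightarrow> bool" where
  "supertangent \<phi> U s \<longleftrightarrow>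
     \<phi> C1_differentiable_on UNIV \<and>
     (\<forall>\<^sub>F t in at s within {0..1}. U t - \<phi> t \<le> U s - \<phi> s)"

definition subtangent :: "(real \<Rightarrow> real) \<Rightarrow> (real \<Rightarrow> real) \<Rightarrow> real \<Rightarrow> bool" where
  "subtangent \<phi> U s \<longleftrightarrow>
     \<phi> C1_differentiable_on UNIV \<and>
     (\<forall>\<^sub>F t in at s within {0..1}. U s - \<phi> s \<le> U t - \<phi> t)"

definition visc_sub_at ::
  "(real \<Rightarrow> real \<Rightarrow> real) \<Rightarrow> real \<Rightarrow> (real \<Rightarrow> real) \<Rightarrow> real \<Rightarrow> bool" where
  "visc_sub_at F a U s \<longleftrightarrow> (\<forall>\<phi>. supertangent \<phi> U s \<longrightarrow> F s (deriv \<phi> s) \<le> a)"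

definition visc_super_at ::
  "(real \<Rightarrow> real \<Rightarrow> real) \<Rightarrow> real \<Rightarrow> (real \<Rightarrow> real) \<Rightarrow> real \<Rightarrow> bool" where
  "visc_super_at F a U s \<longleftrightarrow> (\<forall>\<phi>. subtangent \<phi> U s \<longrightarrow> F s (deriv \<phi> s) \<ge> a)"

definition subsolution ::
  "(real \<Rightarrow> 'a::euclidean_space) set \<Rightarrow> ((real \<Rightarrow> 'a) \<Rightarrow> real \<Rightarrow> real \<Rightarrow> real) \<Rightarrow> real
    \<Rightarrow> ('a \<Rightarrow> real) \<Rightarrow> bool" where
  "subsolution E H a w \<longleftrightarrow>
     continuous_on (network_space E) w \<and>
     (\<forall>\<gamma>\<in>E. \<forall>s\<in>{0<..<1}. visc_sub_at (H \<gamma>) a (w \<circ> \<gamma>) s)"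

definition supersolution_in ::
  "(real \<Rightarrow> 'a::euclidean_space) set \<Rightarrow> ((real \<Rightarrow> 'a) \<Rightarrow> real \<Rightarrow> real \<Rightarrow> real) \<Rightarrow> real
    \<Rightarrow> 'a set \<Rightarrow> ('a \<Rightarrow> real) \<Rightarrow> bool" where
  "supersolution_in E H a S v \<longleftrightarrow>
     continuous_on (network_space E) v \<and>
     (\<forall>\<gamma>\<in>E. \<forall>s\<in>{0<..<1}. \<gamma> s \<in> S \<longrightarrow> visc_super_at (H \<gamma>) a (v \<circ> \<gamma>) s) \<and>
     (\<forall>x\<in>vertices E \<inter> S. \<exists>\<gamma>\<in>arcs_into E x. visc_super_at (H \<gamma>) a (v \<circ> \<gamma>) 1)"

section \<open>Critical value\<close>

text \<open>For a network Hamiltonian the infimum over \<open>\<mu>\<close> and the supremum over s are attained.\<close>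

definition arc_critical_value :: "(real \<Rightarrow> real \<Rightarrow> real) \<Rightarrow> real" where
  "arc_critical_value F = (SUP s\<in>{0..1}. INF \<mu>. F s \<mu>)"

definition min_level ::
  "(real \<Rightarrow> 'a::euclidean_space) set \<Rightarrow> ((real \<Rightarrow> 'a) \<Rightarrow> real \<Rightarrow> real \<Rightarrow> real) \<Rightarrow> real" where
  "min_level E H = Max ((\<lambda>\<gamma>. arc_critical_value (H \<gamma>)) ` E)"

definition critical_value ::
  "(real \<Rightarrow> 'a::euclidean_space) set \<Rightarrow> ((real \<Rightarrow> 'a) \<Rightarrow> real \<Rightarrow> real \<Rightarrow> real) \<Rightarrow> real" where
  "critical_value E H = Inf {a. min_level E H \<le> a \<and> (\<exists>w. subsolution E H a w)}"

section \<open>Support functions\<close>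

text \<open>By strict quasiconvexity \<open>{\<mu>. H \<gamma> s \<mu> = a}\<close> has at most two elements, so the suprema and
  infima below are maxima and minima unless that set is empty; in \<open>ereal\<close> the supremum and infimum
  of the empty set are \<open>-\<infinity>\<close> and \<open>\<infinity>\<close>.\<close>

definition sigma_plus :: "(real \<Rightarrow> real \<Rightarrow> real) \<Rightarrow> real \<Rightarrow> real \<Rightarrow> ereal" where
  "sigma_plus F a s = Sup (ereal ` {\<mu>. F s \<mu> = a})"

definition sigma_minus :: "(real \<Rightarrow> real \<Rightarrow> real) \<Rightarrow> real \<Rightarrow> real \<Rightarrow> ereal" where
  "sigma_minus F a s = Inf (ereal ` {\<mu>. F s \<mu> = a})"

definition arc_support ::
  "(real \<Rightarrow> 'a::euclidean_space) \<Rightarrow> (real \<Rightarrow> real \<Rightarrow> real) \<Rightarrow> real \<Rightarrow> real \<Rightarrow> 'a \<Rightarrow> ereal" where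
  "arc_support \<gamma> F a s q =
     Sup ((\<lambda>\<mu>. ereal (\<mu> * ((q \<bullet> arc_velocity \<gamma> s) / (norm (arc_velocity \<gamma> s))\<^sup>2))) ` {\<mu>. F s \<mu> = a})"

text \<open>Off the vertices, x determines the arc through it and the parameter s up to reversal
  \<open>(\<gamma>, s) \<mapsto> (reversepath \<gamma>, 1 - s)\<close>, which does not change \<open>arc_support\<close>, so the outer supremum
  there is over equal values.  The values at pairs (x, q) with q not tangent to the network at x
  have no meaning.\<close>

definition sigma ::
  "(real \<Rightarrow> 'a::euclidean_space) set \<Rightarrow> ((real \<Rightarrow> 'a) \<Rightarrow> real \<Rightarrow> real \<Rightarrow> real) \<Rightarrow> real
    \<Rightarrow> 'a \<Rightarrow> 'a \<Rightarrow> ereal" where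
  "sigma E H a x q =
     (if x \<in> vertices E then
        (if q = 0 then 0
         else Inf {arc_support \<gamma> (H \<gamma>) a 1 q | \<gamma>.
                     \<gamma> \<in> arcs_into E x \<and> (\<exists>r. q = r *\<^sub>R arc_velocity \<gamma> 1)})
      else Sup {arc_support \<gamma> (H \<gamma>) a s q | \<gamma> s. \<gamma> \<in> E \<and> s \<in> {0<..<1} \<and> \<gamma> s = x})"

section \<open>Curves and the Aubry set\<close>

definition abs_continuous_on_interval :: "real \<Rightarrow> real \<Rightarrow> (real \<Rightarrow> 'a::euclidean_space) \<Rightarrow> bool" where
  "abs_continuous_on_interval a b f \<longleftrightarrow>
     (\<forall>\<epsilon>>0. \<exists>\<delta>>0. \<forall>(n::nat) l r.
        (\<forall>i<n. a \<le> l i \<and> l i \<le> r i \<and> r i \<le> b) \<and>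
        (\<forall>i<n. \<forall>j<n. i \<noteq> j \<longrightarrow> {l i<..<r i} \<inter> {l j<..<r j} = {}) \<and>
        (\<Sum>i<n. r i - l i) < \<delta>
        \<longrightarrow> (\<Sum>i<n. dist (f (l i)) (f (r i))) < \<epsilon>)"

definition network_curve ::
  "(real \<Rightarrow> 'a::euclidean_space) set \<Rightarrow> real \<Rightarrow> (real \<Rightarrow> 'a) \<Rightarrow> bool" where
  "network_curve E T \<xi> \<longleftrightarrow>
     0 \<le> T \<and> abs_continuous_on_interval 0 T \<xi> \<and> \<xi> ` {0..T} \<subseteq> network_space E"

definition closed_simple_curve ::
  "(real \<Rightarrow> 'a::euclidean_space) set \<Rightarrow> real \<Rightarrow> (real \<Rightarrow> 'a) \<Rightarrow> bool" where
  "closed_simple_curve E T \<xi> \<longleftrightarrow>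
     network_curve E T \<xi> \<and> 0 < T \<and> \<xi> 0 = \<xi> T \<and> inj_on \<xi> {0..<T}"

text \<open>At levels a not below \<open>min_level\<close>, in particular at the critical one, \<open>sigma\<close> is finite on the
  tangent bundle, so for almost every time \<open>real_of_ereal\<close> loses nothing.\<close>

definition curve_integrand ::
  "(real \<Rightarrow> 'a::euclidean_space) set \<Rightarrow> ((real \<Rightarrow> 'a) \<Rightarrow> real \<Rightarrow> real \<Rightarrow> real) \<Rightarrow> real
    \<Rightarrow> real \<Rightarrow> (real \<Rightarrow> 'a) \<Rightarrow> real \<Rightarrow> real" where
  "curve_integrand E H a T \<xi> \<tau> =
     real_of_ereal (sigma E H a (\<xi> \<tau>) (vector_derivative \<xi> (at \<tau> within {0..T})))"

text \<open>The Aubry set is the union of its two parts; no closure is taken, the union is closed.\<close>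

definition aubry_set ::
  "(real \<Rightarrow> 'a::euclidean_space) set \<Rightarrow> ((real \<Rightarrow> 'a) \<Rightarrow> real \<Rightarrow> real \<Rightarrow> real) \<Rightarrow> 'a set" where
  "aubry_set E H =
     {x. \<exists>T \<xi>. closed_simple_curve E T \<xi> \<and> x \<in> \<xi> ` {0..T} \<and>
            set_integrable lebesgue {0..T} (curve_integrand E H (critical_value E H) T \<xi>) \<and>
            (LINT \<tau>:{0..T}|lebesgue. curve_integrand E H (critical_value E H) T \<xi> \<tau>) = 0} \<union>
     {\<gamma> s | \<gamma> s. \<gamma> \<in> E \<and> s \<in> {0..1} \<and>
            sigma_plus (H \<gamma>) (critical_value E H) s = sigma_minus (H \<gamma>) (critical_value E H) s}"

end

theory Submission
  imports Defs
begin

text \<open>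
  Let \<open>c\<close> be the critical value.  Suppose \<open>w - v\<close> has a positive maximum \<open>M\<close> on the network;
  the points where it is attained form the contact set of \<open>w - M\<close> and \<open>v\<close>, which avoids
  \<open>\<Gamma>'\<close> and hence the Aubry set.  At every level not below the minimal one the slopes with
  Hamiltonian at most that level form an interval, and by the second part of the Aubry set this
  interval is nondegenerate near the contact set.

  Along an arc, increments of a subsolution are bounded by integrals of the maximal and of the
  minimal slope (\<open>visc_sub_increment_le\<close>).  A supersolution satisfies the opposite bound in at
  least one direction: backward with the maximal slope or forward with the minimal one
  (\<open>visc_super_interior_dichotomy\<close>), and at a vertex backward along some arc ending there
  (\<open>visc_super_endpoint_bound\<close>).  At a contact point the two bounds force equality, so contact
  spreads in that direction; it cannot turn around, as \<open>w\<close> would have both extremal slopes on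
  the same piece, so it spreads back to the initial point of the arc (\<open>contact_backward\<close>).

  Consequently a nonempty contact set contains a vertex, and from every contact vertex one can
  go back along an arc consisting of contact points, on which \<open>w\<close> has the maximal slope, to
  another contact vertex (\<open>contact_reaches_vertex\<close>, \<open>contact_vertex_arc\<close>).  There are finitely
  many vertices, so some such arcs close up to a cycle through distinct vertices.  The cycle
  contains no arc together with its reverse, since the extremal slopes differ on it; hence it is
  a closed simple curve (\<open>closed_simple_chain_curve\<close>).  Its length is the total increment of
  \<open>w\<close> around it, which is zero (\<open>curve_integral_zero\<close>), so it lies in the Aubry set: a
  contradiction.
\<close>

section \<open>Hamiltonians on an arc and their extremal slopes\<close>

text \<open>The data of one arc: a Hamiltonian on \<open>[0,1]\<close> that is continuous, coercive and strictly
  quasiconvex in the slope, together with a level at which every sublevel set is nonempty.\<close>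

definition admissible :: "(real \<Rightarrow> real \<Rightarrow> real) \<Rightarrow> real \<Rightarrow> bool" where
  "admissible F a \<longleftrightarrow>
     continuous_on ({0..1} \<times> UNIV) (\<lambda>(s, \<mu>). F s \<mu>) \<and>
     (\<forall>s\<in>{0..1}. filterlim (F s) at_top at_infinity) \<and>
     (\<forall>s\<in>{0..1}. \<forall>\<mu> \<mu>' \<rho>. \<mu> \<noteq> \<mu>' \<and> 0 < \<rho> \<and> \<rho> < 1 \<longrightarrow>
        F s (\<rho> * \<mu> + (1 - \<rho>) * \<mu>') < max (F s \<mu>) (F s \<mu>')) \<and>
     (\<forall>s\<in>{0..1}. \<exists>\<mu>. F s \<mu> \<le> a)"

text \<open>The endpoints of the sublevel interval.  They agree with \<^const>\<open>sigma_plus\<close> and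
  \<^const>\<open>sigma_minus\<close> for admissible data but are real-valued.\<close>

definition slope_max :: "(real \<Rightarrow> real \<Rightarrow> real) \<Rightarrow> real \<Rightarrow> real \<Rightarrow> real" where
  "slope_max F a s = Sup {\<mu>. F s \<mu> \<le> a}"

definition slope_min :: "(real \<Rightarrow> real \<Rightarrow> real) \<Rightarrow> real \<Rightarrow> real \<Rightarrow> real" where
  "slope_min F a s = Inf {\<mu>. F s \<mu> \<le> a}"

text \<open>The Hamiltonian seen along the reversed arc; it exchanges the two extremal slopes.\<close>

definition reversed :: "(real \<Rightarrow> real \<Rightarrow> real) \<Rightarrow> real \<Rightarrow> real \<Rightarrow> real" where
  "reversed F s \<mu> = F (1 - s) (- \<mu>)"

lemma admissible_continuous_slope:
  assumes "admissible F a" "s \<in> {0..1}"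
  shows "continuous_on UNIV (F s)"
proof -
  have "continuous_on UNIV ((\<lambda>(s, \<mu>). F s \<mu>) \<circ> (\<lambda>\<mu>. (s, \<mu>)))"
    using assms by (intro continuous_on_compose continuous_intros)
      (auto simp: admissible_def intro: continuous_on_subset)
  then show ?thesis by (simp add: o_def)
qed

lemma admissible_continuous_position:
  assumes "admissible F a"
  shows "continuous_on {0..1} (\<lambda>s. F s \<mu>)"
proof -
  have "continuous_on {0..1} ((\<lambda>(s, \<mu>). F s \<mu>) \<circ> (\<lambda>s. (s, \<mu>)))"
    using assms by (intro continuous_on_compose continuous_intros)
      (auto simp: admissible_def intro: continuous_on_subset)
  then show ?thesis by (simp add: o_def)
qed

lemma admissible_strict_quasiconvex:
  assumes "admissible F a" "s \<in> {0..1}" "x < y" "y < z"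
  shows "F s y < max (F s x) (F s z)"
proof -
  define \<rho> where "\<rho> = (z - y) / (z - x)"
  have "0 < \<rho>" "\<rho> < 1" using assms by (auto simp: \<rho>_def)
  moreover have "\<rho> * x + (1 - \<rho>) * z = y"
  proof -
    have "\<rho> * (z - x) = z - y" using assms by (simp add: \<rho>_def)
    then show ?thesis by (simp add: algebra_simps)
  qed
  moreover have "x \<noteq> z" using assms by auto
  ultimately show ?thesis using assms unfolding admissible_def by metis
qed

lemma admissible_sublevel_compact:
  assumes "admissible F a" "s \<in> {0..1}"
  shows "compact {\<mu>. F s \<mu> \<le> a}" "{\<mu>. F s \<mu> \<le> a} \<noteq> {}"
proof -
  have "eventually (\<lambda>\<mu>. a < F s \<mu>) at_infinity"
    using assms by (auto simp: admissible_def filterlim_at_top_dense)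
  then obtain b where b: "\<And>\<mu>. b \<le> norm \<mu> \<Longrightarrow> a < F s \<mu>"
    unfolding eventually_at_infinity by blast
  have "{\<mu>. F s \<mu> \<le> a} \<subseteq> cball 0 b"
    using b by (force simp: not_less[symmetric])
  then have "bounded {\<mu>. F s \<mu> \<le> a}" using bounded_cball bounded_subset by blast
  moreover have "closed {\<mu>. F s \<mu> \<le> a}"
    using admissible_continuous_slope[OF assms] by (intro closed_Collect_le continuous_intros)
  ultimately show "compact {\<mu>. F s \<mu> \<le> a}" by (simp add: compact_eq_bounded_closed)
  show "{\<mu>. F s \<mu> \<le> a} \<noteq> {}" using assms by (auto simp: admissible_def)
qed

lemma slope_max_upper:
  assumes "admissible F a" "s \<in> {0..1}" "F s \<mu> \<le> a"
  shows "\<mu> \<le> slope_max F a s"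
  unfolding slope_max_def
  using admissible_sublevel_compact[OF assms(1,2)] assms(3)
  by (intro cSup_upper) (auto dest: compact_imp_bounded bounded_imp_bdd_above)

lemma slope_max_level:
  assumes "admissible F a" "s \<in> {0..1}"
  shows "F s (slope_max F a s) = a"
proof -
  have "slope_max F a s \<in> {\<mu>. F s \<mu> \<le> a}"
    unfolding slope_max_def using admissible_sublevel_compact[OF assms]
    by (intro closed_contains_Sup)
      (auto dest: compact_imp_bounded compact_imp_closed bounded_imp_bdd_above)
  moreover have "\<not> F s (slope_max F a s) < a"
  proof
    assume "F s (slope_max F a s) < a"
    moreover have "isCont (F s) (slope_max F a s)"
      using admissible_continuous_slope[OF assms] by (simp add: continuous_on_eq_continuous_at)
    ultimately have "eventually (\<lambda>\<mu>. F s \<mu> < a) (at (slope_max F a s))"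
      unfolding isCont_def by (rule order_tendstoD(2)[rotated])
    then have "eventually (\<lambda>\<mu>. F s \<mu> < a) (at_right (slope_max F a s))"
      by (simp add: eventually_at_split)
    then obtain b where b: "b > slope_max F a s"
        "\<And>y. slope_max F a s < y \<Longrightarrow> y < b \<Longrightarrow> F s y < a"
      unfolding eventually_at_right_field by blast
    obtain y where "slope_max F a s < y" "y < b" using b(1) dense by blast
    with b(2)[of y] slope_max_upper[OF assms, of y] show False by force
  qed
  ultimately show ?thesis by auto
qed

lemma above_slope_max:
  assumes "admissible F a" "s \<in> {0..1}" "slope_max F a s < \<mu>"
  shows "a < F s \<mu>"
  using slope_max_upper[OF assms(1,2), of \<mu>] assms(3) by force

lemma reversed_admissible:
  assumes "admissible F a"
  shows "admissible (reversed F) a"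
  unfolding admissible_def
proof (intro conjI ballI allI impI)
  have "continuous_on ({0..1} \<times> UNIV) ((\<lambda>(s, \<mu>). F s \<mu>) \<circ> (\<lambda>(s, \<mu>). (1 - s, - \<mu>)))"
    using assms
    by (intro continuous_on_compose)
      (auto simp: admissible_def split_beta intro!: continuous_intros
        intro: continuous_on_subset)
  then show "continuous_on ({0..1} \<times> UNIV) (\<lambda>(s, \<mu>). reversed F s \<mu>)"
    by (simp add: o_def reversed_def split_beta)
next
  fix s :: real assume s: "s \<in> {0..1}"
  then have s': "1 - s \<in> {0..1}" by auto
  have "filterlim (uminus :: real \<Rightarrow> real) at_infinity at_infinity"
    unfolding filterlim_at_infinity[OF order_refl]
    by (auto simp: eventually_at_infinity)
  then show "filterlim (reversed F s) at_top at_infinity"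
    using assms s' unfolding reversed_def admissible_def
    by (blast intro: filterlim_compose)
  obtain \<mu> where "F (1 - s) \<mu> \<le> a" using assms s' unfolding admissible_def by blast
  then have "reversed F s (- \<mu>) \<le> a" by (simp add: reversed_def)
  then show "\<exists>\<mu>. reversed F s \<mu> \<le> a" by blast
  fix \<mu> \<mu>' \<rho> :: real
  assume *: "\<mu> \<noteq> \<mu>' \<and> 0 < \<rho> \<and> \<rho> < 1"
  have "F (1 - s) (\<rho> * (- \<mu>) + (1 - \<rho>) * (- \<mu>')) < max (F (1 - s) (- \<mu>)) (F (1 - s) (- \<mu>'))"
    using assms s' * unfolding admissible_def by (metis neg_equal_iff_equal)
  then show "reversed F s (\<rho> * \<mu> + (1 - \<rho>) * \<mu>') < max (reversed F s \<mu>) (reversed F s \<mu>')"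
    by (simp add: reversed_def algebra_simps)
qed

lemma slope_max_reversed: "slope_max (reversed F) a s = - slope_min F a (1 - s)"
proof -
  have "{\<mu>. F (1 - s) (- \<mu>) \<le> a} = uminus ` {\<mu>. F (1 - s) \<mu> \<le> a}"
    by (force intro: image_eqI[where x = "- x" for x])
  then show ?thesis
    by (simp add: slope_max_def slope_min_def reversed_def Inf_real_def)
qed

lemma slope_min_level:
  assumes "admissible F a" "s \<in> {0..1}"
  shows "F s (slope_min F a s) = a"
  using slope_max_level[OF reversed_admissible[OF assms(1)], of "1 - s"] assms(2)
  by (simp add: slope_max_reversed reversed_def)

lemma slope_min_lower:
  assumes "admissible F a" "s \<in> {0..1}" "F s \<mu> \<le> a"
  shows "slope_min F a s \<le> \<mu>"
  using slope_max_upper[OF reversed_admissible[OF assms(1)], of "1 - s" "- \<mu>"] assms(2,3)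
  by (simp add: slope_max_reversed reversed_def)

lemma slope_min_le_max:
  assumes "admissible F a" "s \<in> {0..1}"
  shows "slope_min F a s \<le> slope_max F a s"
  using slope_max_upper[OF assms] slope_min_level[OF assms] by simp

lemma between_slopes:
  assumes "admissible F a" "s \<in> {0..1}" "slope_min F a s < \<mu>" "\<mu> < slope_max F a s"
  shows "F s \<mu> < a"
  using admissible_strict_quasiconvex[OF assms] slope_max_level[OF assms(1,2)]
    slope_min_level[OF assms(1,2)] by simp

lemma sigma_plus_eq_slope_max:
  assumes "admissible F a" "s \<in> {0..1}"
  shows "sigma_plus F a s = ereal (slope_max F a s)"
  unfolding sigma_plus_def
  using slope_max_level[OF assms] slope_max_upper[OF assms]
  by (intro Sup_eqI) auto

lemma sigma_minus_eq_slope_min: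
  assumes "admissible F a" "s \<in> {0..1}"
  shows "sigma_minus F a s = ereal (slope_min F a s)"
  unfolding sigma_minus_def
  using slope_min_level[OF assms] slope_min_lower[OF assms]
  by (intro Inf_eqI) auto

text \<open>Strictness of the quasiconvexity makes the sublevel interval depend continuously on the
  position: a flat piece of \<open>F s\<close> at the level \<open>a\<close> could make an endpoint jump.\<close>

lemma continuous_on_slope_max:
  assumes "admissible F a"
  shows "continuous_on {0..1} (slope_max F a)"
  unfolding continuous_on_def
proof
  fix s :: real assume s: "s \<in> {0..1}"
  let ?m = "slope_max F a s"
  have cont: "((\<lambda>s. F s \<mu>) \<longlongrightarrow> F s \<mu>) (at s within {0..1})" for \<mu>
    using admissible_continuous_position[OF assms] s by (auto simp: continuous_on_def)
  have dom: "eventually (\<lambda>t. t \<in> {0..1::real}) (at s within {0..1})"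
    by (simp add: eventually_at_filter)
  show "(slope_max F a \<longlongrightarrow> ?m) (at s within {0..1})"
  proof (rule order_tendstoI)
    fix b assume b: "?m < b"
    have "a < F s b" using above_slope_max[OF assms s b] .
    then obtain d where d: "a < d" "d < F s b" using dense by blast
    have "F s ?m < d" using d slope_max_level[OF assms s] by simp
    with order_tendstoD(2)[OF cont] have e1: "eventually (\<lambda>t. F t ?m < d) (at s within {0..1})" .
    have e2: "eventually (\<lambda>t. d < F t b) (at s within {0..1})"
        by (rule order_tendstoD(1)[OF cont d(2)])
    from e1 e2 dom show "eventually (\<lambda>t. slope_max F a t < b) (at s within {0..1})"
    proof eventually_elim
      case (elim t)
      have l: "F t (slope_max F a t) = a" using slope_max_level[OF assms elim(3)] .
      show ?case
      proof (rule ccontr)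
        assume "\<not> ?thesis"
        then consider "slope_max F a t = b" | "b < slope_max F a t" by linarith
        then show False
        proof cases
          case 1 with l elim d show False by simp
        next
          case 2
          from admissible_strict_quasiconvex[OF assms elim(3) b this] elim l d
          show False by simp
        qed
      qed
    qed
  next
    fix b assume b: "b < ?m"
    show "eventually (\<lambda>t. b < slope_max F a t) (at s within {0..1})"
    proof (cases "slope_min F a s < ?m")
      case True
      then obtain m where m: "max b (slope_min F a s) < m" "m < ?m"
        using dense[of "max b (slope_min F a s)" ?m] b by auto
      then have "F s m < a" using between_slopes[OF assms s] by simp
      from order_tendstoD(2)[OF cont this] dom show ?thesis
      proof eventually_elim
        case (elim t)
        then have "m \<le> slope_max F a t" using slope_max_upper[OF assms] by simp
        with m show ?case by simp
      qed
    next
      case False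
      then have eq: "slope_min F a s = ?m" using slope_min_le_max[OF assms s] by simp
      have "a < F s b" using slope_min_lower[OF assms s, of b] eq b by force
      then obtain d where d: "a < d" "d < F s b" using dense by blast
      have "F s ?m < d" using d slope_max_level[OF assms s] by simp
      with order_tendstoD(2)[OF cont] have e1: "eventually (\<lambda>t. F t ?m < d) (at s within {0..1})" .
      have e2: "eventually (\<lambda>t. d < F t b) (at s within {0..1})"
        by (rule order_tendstoD(1)[OF cont d(2)])
      from e1 e2 dom show ?thesis
      proof eventually_elim
        case (elim t)
        have l: "F t (slope_max F a t) = a" using slope_max_level[OF assms elim(3)] .
        show ?case
        proof (rule ccontr)
          assume "\<not> ?thesis"
          then consider "slope_max F a t = b" | "slope_max F a t < b" by linarith
          then show False
          proof cases
            case 1 with l elim d show False by simp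
          next
            case 2
            from admissible_strict_quasiconvex[OF assms elim(3) this b] elim l d
            show False by simp
          qed
        qed
      qed
    qed
  qed
qed

lemma continuous_on_slope_min:
  assumes "admissible F a"
  shows "continuous_on {0..1} (slope_min F a)"
proof -
  have "continuous_on {0..1} (\<lambda>s. - slope_max (reversed F) a (1 - s))"
    by (intro continuous_intros continuous_on_compose2[OF continuous_on_slope_max]
        reversed_admissible assms) auto
  then show ?thesis by (simp add: slope_max_reversed)
qed

section \<open>Primitives of functions on the unit interval\<close>

text \<open>Primitives live on the whole line because test functions have to be continuously
  differentiable there.\<close>

definition primitive_on_unit :: "(real \<Rightarrow> real) \<Rightarrow> (real \<Rightarrow> real) \<Rightarrow> bool" where
  "primitive_on_unit G g \<longleftrightarrow>
     G C1_differentiable_on UNIV \<and> (\<forall>t\<in>{0..1}. (G has_real_derivative g t) (at t))"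

lemma primitive_on_unit_exists:
  assumes "continuous_on {0..1} g"
  shows "\<exists>G. primitive_on_unit G g"
proof -
  define h where "h t = g (max 0 (min 1 t))" for t :: real
  have h: "continuous_on UNIV h"
    unfolding h_def by (intro continuous_on_compose2[OF assms] continuous_intros) auto
  have "\<exists>G. \<forall>x::real. - \<infinity> < ereal x \<longrightarrow> ereal x < \<infinity> \<longrightarrow> (G has_vector_derivative h x) (at x)"
    using h by (intro einterval_antiderivative) (auto simp: continuous_on_eq_continuous_at)
  then obtain G where G: "\<And>x. (G has_vector_derivative h x) (at x)" by auto
  then have "G C1_differentiable_on UNIV" using h by (auto simp: C1_differentiable_on_def)
  moreover have "(G has_real_derivative g t) (at t)" if "t \<in> {0..1}" for t
    using G[of t] that by (simp add: h_def has_real_derivative_iff_has_vector_derivative)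
  ultimately show ?thesis by (auto simp: primitive_on_unit_def)
qed

lemma primitive_on_unit_continuous:
  assumes "primitive_on_unit G g"
  shows "continuous_on A G"
proof -
  have "continuous_on UNIV G"
    using assms by (auto simp: primitive_on_unit_def intro: C1_differentiable_imp_continuous_on)
  then show ?thesis by (rule continuous_on_subset) simp
qed

lemma primitive_on_unit_reflect:
  assumes "primitive_on_unit G g" "\<And>t. t \<in> {0..1} \<Longrightarrow> h t = - g (1 - t)"
  shows "primitive_on_unit (\<lambda>t. G (1 - t)) h"
proof -
  obtain D where D: "\<And>x. (G has_real_derivative D x) (at x)" "continuous_on UNIV D"
    using assms(1) by (auto simp: primitive_on_unit_def C1_differentiable_on_def
        has_real_derivative_iff_has_vector_derivative)
  have refl: "((\<lambda>t. G (1 - t)) has_real_derivative - d) (at t)"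
    if "(G has_real_derivative d) (at (1 - t))" for t d
  proof -
    have "((\<lambda>t. 1 - t) has_real_derivative - 1) (at t)"
      by (auto intro!: derivative_eq_intros)
    from DERIV_chain2[OF that this] show ?thesis by simp
  qed
  have "continuous_on UNIV (\<lambda>t. - D (1 - t))"
    by (intro continuous_intros continuous_on_compose2[OF D(2)]) auto
  then have "(\<lambda>t. G (1 - t)) C1_differentiable_on UNIV"
    unfolding C1_differentiable_on_def has_real_derivative_iff_has_vector_derivative[symmetric]
    using refl[OF D(1)] by (intro exI[of _ "\<lambda>t. - D (1 - t)"]) auto
  moreover have "((\<lambda>t. G (1 - t)) has_real_derivative h t) (at t)" if "t \<in> {0..1}" for t
  proof -
    have "(G has_real_derivative g (1 - t)) (at (1 - t))"
      using assms(1) that by (auto simp: primitive_on_unit_def)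
    from refl[OF this] show ?thesis using assms(2)[OF that] by simp
  qed
  ultimately show ?thesis by (simp add: primitive_on_unit_def)
qed

lemma C1_differentiable_on_UNIV_iff:
  fixes \<phi> :: "real \<Rightarrow> real"
  shows "\<phi> C1_differentiable_on UNIV \<longleftrightarrow>
    (\<exists>D. (\<forall>x. (\<phi> has_real_derivative D x) (at x)) \<and> continuous_on UNIV D)"
  by (simp add: C1_differentiable_on_def has_real_derivative_iff_has_vector_derivative)

lemma primitive_on_unitE:
  assumes "primitive_on_unit G g"
  obtains D where "\<And>x. (G has_real_derivative D x) (at x)" "continuous_on UNIV D"
    "\<And>t. t \<in> {0..1} \<Longrightarrow> D t = g t"
proof -
  obtain D where D: "\<And>x. (G has_real_derivative D x) (at x)" "continuous_on UNIV D"
    using assms unfolding primitive_on_unit_def C1_differentiable_on_UNIV_iff by blast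
  moreover have "D t = g t" if "t \<in> {0..1}" for t
    using DERIV_unique[OF D(1)[of t]] assms that by (simp add: primitive_on_unit_def)
  ultimately show ?thesis using that by blast
qed

lemma eventually_at_within_unit_open:
  assumes "open N" "s \<in> N" "\<And>t. t \<in> N \<Longrightarrow> t \<in> {0..1} \<Longrightarrow> P t"
  shows "eventually P (at s within {0..1::real})"
  using assms unfolding eventually_at_topological by blast

section \<open>Viscosity sub- and supersolutions along an arc\<close>

text \<open>If the increment bound failed between \<open>s\<close> and \<open>t\<close>, a steep exponential added to \<open>G\<close>
  would force an interior maximum of \<open>f\<close> minus a test function whose slope exceeds
  \<open>slope_max\<close>.\<close>

lemma visc_sub_increment_le_interior:
  assumes adm: "admissible F a" and f: "continuous_on {0..1} f"
    and sub: "\<forall>s\<in>{0<..<1}. visc_sub_at F a f s"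
    and G: "primitive_on_unit G (slope_max F a)"
    and st: "0 \<le> s" "s < t" "t < 1"
  shows "f t - f s \<le> G t - G s"
proof (rule ccontr)
  assume contr: "\<not> ?thesis"
  define \<delta> where "\<delta> = ((f t - G t) - (f s - G s)) / 2"
  have \<delta>: "0 < \<delta>" "f s - G s = f t - G t - 2 * \<delta>"
    using contr by (auto simp: \<delta>_def field_simps)
  \<comment> \<open>\<open>\<delta>\<close> makes \<open>t\<close> beat \<open>s\<close> in the maximisation of \<open>f - \<phi>\<close> below; \<open>k\<close> is so
    large that \<open>t\<close> beats \<open>1\<close> as well.\<close>
  define X where "X = \<bar>(f 1 - G 1) - (f t - G t)\<bar> / \<delta>"
  have X: "0 \<le> X" "\<delta> * X = \<bar>(f 1 - G 1) - (f t - G t)\<bar>"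
    using \<delta> by (auto simp: X_def)
  define k where "k = (X + 1) / (1 - t)"
  have k: "0 < k" "k * (1 - t) = X + 1" using X st by (auto simp: k_def)
  define \<phi> where "\<phi> \<tau> = G \<tau> + \<delta> * exp (k * (\<tau> - t))" for \<tau>
  obtain D where D: "\<And>x. (G has_real_derivative D x) (at x)" "continuous_on UNIV D"
      "\<And>t. t \<in> {0..1} \<Longrightarrow> D t = slope_max F a t"
    using primitive_on_unitE[OF G] by blast
  have d\<phi>: "(\<phi> has_real_derivative D x + \<delta> * k * exp (k * (x - t))) (at x)" for x
    unfolding \<phi>_def by (auto intro!: derivative_eq_intros D(1))
  have C1: "\<phi> C1_differentiable_on UNIV"
    unfolding C1_differentiable_on_UNIV_iff using d\<phi>
    by (intro exI[of _ "\<lambda>x. D x + \<delta> * k * exp (k * (x - t))"] conjI)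
       (auto intro!: continuous_intros D(2))
  have cont: "continuous_on {s..1} (\<lambda>\<tau>. f \<tau> - \<phi> \<tau>)"
    unfolding \<phi>_def using st
    by (intro continuous_intros continuous_on_subset[OF f] primitive_on_unit_continuous[OF G]) auto
  then obtain \<tau> where \<tau>: "\<tau> \<in> {s..1}" "\<And>y. y \<in> {s..1} \<Longrightarrow> f y - \<phi> y \<le> f \<tau> - \<phi> \<tau>"
    using continuous_attains_sup[of "{s..1}" "\<lambda>\<tau>. f \<tau> - \<phi> \<tau>"] st by auto
  have at_t: "f t - \<phi> t = f t - G t - \<delta>" by (simp add: \<phi>_def)
  have "0 < \<delta> * exp (k * (s - t))" using \<delta> by simp
  then have "f s - \<phi> s < f t - \<phi> t" using \<delta> at_t unfolding \<phi>_def by linarith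
  then have "\<tau> \<noteq> s" using \<tau>(2)[of t] st by auto
  have "1 + (X + 1) \<le> exp (k * (1 - t))"
    using exp_ge_add_one_self[of "k * (1 - t)"] k(2) by simp
  then have "\<delta> * (X + 2) \<le> \<delta> * exp (k * (1 - t))" using \<delta> by simp
  then have "f 1 - \<phi> 1 < f t - \<phi> t"
    using \<delta> X at_t by (simp add: \<phi>_def algebra_simps)
  then have "\<tau> \<noteq> 1" using \<tau>(2)[of t] st by auto
  then have \<tau>': "s < \<tau>" "\<tau> < 1" "\<tau> \<in> {0..1}" using \<tau>(1) \<open>\<tau> \<noteq> s\<close> st by auto
  have "eventually (\<lambda>y. f y - \<phi> y \<le> f \<tau> - \<phi> \<tau>) (at \<tau> within {0..1})"
    by (rule eventually_at_within_unit_open[of "{s<..}"]) (use \<tau>(2) \<tau>' in auto)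
  then have "supertangent \<phi> f \<tau>" using C1 by (simp add: supertangent_def)
  then have "F \<tau> (deriv \<phi> \<tau>) \<le> a" using sub \<tau>' st by (auto simp: visc_sub_at_def)
  then have "deriv \<phi> \<tau> \<le> slope_max F a \<tau>" using slope_max_upper[OF adm] \<tau>' by simp
  moreover have "deriv \<phi> \<tau> = slope_max F a \<tau> + \<delta> * k * exp (k * (\<tau> - t))"
    using DERIV_imp_deriv[OF d\<phi>] D(3) \<tau>' by simp
  ultimately show False using \<delta>(1) k(1) by (simp add: mult_le_0_iff not_le[symmetric])
qed

lemma visc_sub_increment_le:
  assumes adm: "admissible F a" and f: "continuous_on {0..1} f"
    and sub: "\<forall>s\<in>{0<..<1}. visc_sub_at F a f s"
    and G: "primitive_on_unit G (slope_max F a)"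
    and st: "0 \<le> s" "s \<le> t" "t \<le> 1"
  shows "f t - f s \<le> G t - G s"
proof (cases "s < t \<and> t = 1")
  case False
  then show ?thesis using visc_sub_increment_le_interior[OF adm f sub G, of s t] st
    by (cases "s = t") auto
next
  case True
  have "continuous_on {s..1} (\<lambda>x. f x - G x)"
    using st by (intro continuous_intros continuous_on_subset[OF f]
        primitive_on_unit_continuous[OF G]) auto
  then have "((\<lambda>x. f x - G x) \<longlongrightarrow> f 1 - G 1) (at 1 within {s..1})"
    using st by (auto simp: continuous_on_def)
  then have lim: "((\<lambda>x. f x - G x) \<longlongrightarrow> f 1 - G 1) (at_left 1)"
    using True by (simp add: at_within_Icc_at_left)
  have "eventually (\<lambda>x. f x - G x \<le> f s - G s) (at_left 1)"
    unfolding eventually_at_left_field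
    using visc_sub_increment_le_interior[OF adm f sub G, of s] st True
    by (intro exI[of _ s]) (force simp: algebra_simps)
  then have "f 1 - G 1 \<le> f s - G s"
    by (intro tendsto_upperbound[OF lim]) auto
  then show ?thesis using True by simp
qed

text \<open>The smooth minimum \<open>- ln (exp (- k A) + exp (- k B)) / k\<close> of two functions lies below
  both of them, and its slope is a strict convex combination of theirs.\<close>

lemma smooth_minimum:
  fixes A B :: "real \<Rightarrow> real"
  assumes A: "\<And>x. (A has_real_derivative DA x) (at x)" "continuous_on UNIV DA"
    and B: "\<And>x. (B has_real_derivative DB x) (at x)" "continuous_on UNIV DB"
    and k: "0 < k"
  obtains u where "u C1_differentiable_on UNIV" "\<And>x. u x \<le> A x" "\<And>x. u x \<le> B x"
    "\<And>x. A x = B x \<Longrightarrow> u x = A x - ln 2 / k"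
    "\<And>x. DB x < DA x \<Longrightarrow> DB x < deriv u x \<and> deriv u x < DA x"
proof -
  define p q where "p x = exp (- (k * A x))" and "q x = exp (- (k * B x))" for x
  have pq: "0 < p x" "0 < q x" for x by (auto simp: p_def q_def)
  have pq0: "p x + q x \<noteq> 0" for x using pq[of x] by simp
  have contA: "continuous_on UNIV A" "continuous_on UNIV B"
    using A(1) B(1) by (auto intro!: DERIV_continuous_on)
  define u where "u x = - ln (p x + q x) / k" for x
  define D where "D x = (DA x * p x + DB x * q x) / (p x + q x)" for x
  have dp: "(p has_real_derivative - k * DA x * p x) (at x)"
      and dq: "(q has_real_derivative - k * DB x * q x) (at x)" for x
    unfolding p_def q_def by (auto intro!: derivative_eq_intros A(1) B(1))
  have du: "(u has_real_derivative D x) (at x)" for x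
  proof -
    have "(u has_real_derivative
        - ((- k * DA x * p x + - k * DB x * q x) / (p x + q x)) / k) (at x)"
      unfolding u_def using pq[of x] k
      by (auto intro!: derivative_eq_intros dp dq)
    moreover have "- ((- k * DA x * p x + - k * DB x * q x) / (p x + q x)) / k = D x"
    proof -
      have "- k * DA x * p x + - k * DB x * q x = - k * (DA x * p x + DB x * q x)"
        by (simp add: algebra_simps)
      then show ?thesis using k by (simp add: D_def)
    qed
    ultimately show ?thesis by simp
  qed
  have "continuous_on UNIV D"
    unfolding D_def p_def q_def
    by (intro continuous_intros A(2) B(2) contA) (use pq0 in \<open>auto simp: p_def q_def\<close>)
  then have C1: "u C1_differentiable_on UNIV"
    unfolding C1_differentiable_on_UNIV_iff using du by blast
  have ku: "- (k * u x) = ln (p x + q x)" for x using k by (simp add: u_def)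
  have "ln (p x) \<le> ln (p x + q x)" "ln (q x) \<le> ln (p x + q x)" for x
    using pq[of x] by auto
  then have "- (k * A x) \<le> - (k * u x)" "- (k * B x) \<le> - (k * u x)" for x
    unfolding ku by (auto simp: p_def q_def)
  then have le: "u x \<le> A x" "u x \<le> B x" for x using k by auto
  have eq: "u x = A x - ln 2 / k" if "A x = B x" for x
  proof -
    have "ln (p x + q x) = ln (2 * exp (- (k * A x)))" using that by (simp add: p_def q_def)
    also have "\<dots> = ln 2 - k * A x" by (subst ln_mult) auto
    finally show ?thesis using k by (simp add: u_def field_simps)
  qed
  have slopes: "DB x < deriv u x \<and> deriv u x < DA x" if "DB x < DA x" for x
  proof -
    have "deriv u x = D x" using du by (rule DERIV_imp_deriv)
    moreover have "DB x < D x" "D x < DA x"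
      using that pq[of x] unfolding D_def
      by (simp_all add: pos_less_divide_eq pos_divide_less_eq algebra_simps)
    ultimately show ?thesis by simp
  qed
  show ?thesis using that[OF C1 le eq slopes] .
qed

text \<open>Left of \<open>s\<close> the supersolution is compared with \<open>slope_max\<close>, right of \<open>s\<close> with
  \<open>slope_min\<close>; the resulting concave kink is smoothed from below, which gives a test function
  with slopes strictly inside the sublevel intervals.\<close>

lemma visc_super_interior_dichotomy:
  assumes adm: "admissible F a" and V: "continuous_on {0..1} V"
    and Gp: "primitive_on_unit Gp (slope_max F a)" and Gm: "primitive_on_unit Gm (slope_min F a)"
    and ord: "0 \<le> \<alpha>" "\<alpha> < s" "s < \<beta>" "\<beta> \<le> 1"
    and gap: "\<And>t. \<alpha> < t \<Longrightarrow> t < \<beta> \<Longrightarrow> slope_min F a t < slope_max F a t"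
    and super: "\<And>t. \<alpha> < t \<Longrightarrow> t < \<beta> \<Longrightarrow> visc_super_at F a V t"
  shows "V \<alpha> - V s \<le> Gp \<alpha> - Gp s \<or> V \<beta> - V s \<le> Gm \<beta> - Gm s"
proof (rule ccontr)
  assume contr: "\<not> ?thesis"
  define A B where "A \<tau> = V s + (Gp \<tau> - Gp s)" and "B \<tau> = V s + (Gm \<tau> - Gm s)" for \<tau>
  obtain DA where DA: "\<And>x. (Gp has_real_derivative DA x) (at x)" "continuous_on UNIV DA"
      "\<And>t. t \<in> {0..1} \<Longrightarrow> DA t = slope_max F a t"
    using primitive_on_unitE[OF Gp] by blast
  obtain DB where DB: "\<And>x. (Gm has_real_derivative DB x) (at x)" "continuous_on UNIV DB"
      "\<And>t. t \<in> {0..1} \<Longrightarrow> DB t = slope_min F a t"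
    using primitive_on_unitE[OF Gm] by blast
  have dA: "(A has_real_derivative DA x) (at x)" and dB: "(B has_real_derivative DB x) (at x)" for x
    unfolding A_def B_def by (auto intro!: derivative_eq_intros DA(1) DB(1))
  define e where "e = min (V \<alpha> - A \<alpha>) (V \<beta> - B \<beta>)"
  have e: "0 < e" using contr by (auto simp: e_def A_def B_def)
  \<comment> \<open>Smoothing lowers the kink at \<open>s\<close> by \<open>ln 2 / k\<close>, which must stay below \<open>e\<close>.\<close>
  define k where "k = (ln 2 + 1) / e"
  have "0 < ln (2::real)" by simp
  then have "0 < ln (2::real) + 1" by linarith
  then have k: "0 < k" using e by (simp add: k_def)
  have "k * e = ln 2 + 1" using e by (simp add: k_def)
  then have ke: "ln 2 / k < e" using k by (simp add: field_simps)
  obtain u where u: "u C1_differentiable_on UNIV" "\<And>x. u x \<le> A x" "\<And>x. u x \<le> B x"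
      "\<And>x. A x = B x \<Longrightarrow> u x = A x - ln 2 / k"
      "\<And>x. DB x < DA x \<Longrightarrow> DB x < deriv u x \<and> deriv u x < DA x"
    using smooth_minimum[OF dA DA(2) dB DB(2) k] by blast
  have "continuous_on {\<alpha>..\<beta>} (\<lambda>\<tau>. V \<tau> - u \<tau>)"
    using ord C1_differentiable_imp_continuous_on[OF u(1)]
    by (intro continuous_intros continuous_on_subset[OF V]) (auto intro: continuous_on_subset)
  then obtain \<tau> where \<tau>: "\<tau> \<in> {\<alpha>..\<beta>}" "\<And>y. y \<in> {\<alpha>..\<beta>} \<Longrightarrow> V \<tau> - u \<tau> \<le> V y - u y"
    using continuous_attains_inf[of "{\<alpha>..\<beta>}" "\<lambda>\<tau>. V \<tau> - u \<tau>"] ord by auto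
  have us: "V s - u s = ln 2 / k" using u(4)[of s] by (simp add: A_def B_def)
  have "V \<tau> - u \<tau> < e" using \<tau>(2)[of s] ord us ke by auto
  moreover have "e \<le> V \<alpha> - u \<alpha>" "e \<le> V \<beta> - u \<beta>"
    using u(2)[of \<alpha>] u(3)[of \<beta>] by (auto simp: e_def min_le_iff_disj)
  ultimately have "\<tau> \<noteq> \<alpha>" "\<tau> \<noteq> \<beta>" by auto
  then have \<tau>': "\<alpha> < \<tau>" "\<tau> < \<beta>" "\<tau> \<in> {0..1}" using \<tau>(1) ord by auto
  have "eventually (\<lambda>y. V \<tau> - u \<tau> \<le> V y - u y) (at \<tau> within {0..1})"
    by (rule eventually_at_within_unit_open[of "{\<alpha><..<\<beta>}"]) (use \<tau>(2) \<tau>' in auto)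
  then have "subtangent u V \<tau>" using u(1) by (simp add: subtangent_def)
  then have "a \<le> F \<tau> (deriv u \<tau>)" using super[OF \<tau>'(1,2)] by (auto simp: visc_super_at_def)
  moreover have "F \<tau> (deriv u \<tau>) < a"
    using u(5)[of \<tau>] DA(3) DB(3) gap[OF \<tau>'(1,2)] \<tau>'(3)
    by (intro between_slopes[OF adm]) auto
  ultimately show False by simp
qed

text \<open>At the final point of the arc the test functions are constrained, so a function with a slope
  slightly below \<open>slope_max\<close> serves as test function also there.\<close>

lemma visc_super_endpoint_bound:
  assumes adm: "admissible F a" and V: "continuous_on {0..1} V"
    and Gp: "primitive_on_unit Gp (slope_max F a)" and Gm: "primitive_on_unit Gm (slope_min F a)"
    and \<alpha>: "0 \<le> \<alpha>" "\<alpha> < 1"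
    and gap: "\<And>t. \<alpha> < t \<Longrightarrow> t \<le> 1 \<Longrightarrow> slope_min F a t < slope_max F a t"
    and super: "\<And>t. \<alpha> < t \<Longrightarrow> t \<le> 1 \<Longrightarrow> visc_super_at F a V t"
  shows "V \<alpha> - V 1 \<le> Gp \<alpha> - Gp 1"
proof (rule ccontr)
  assume contr: "\<not> ?thesis"
  define e where "e = (V \<alpha> - V 1) - (Gp \<alpha> - Gp 1)"
  define X where "X = (Gm \<alpha> - Gm 1) - (Gp \<alpha> - Gp 1)"
  \<comment> \<open>The weight \<open>\<epsilon> < 1\<close> of the minimal slope satisfies \<open>\<epsilon> * X < e\<close>.\<close>
  define \<epsilon> where "\<epsilon> = e / (e + \<bar>X\<bar> + 1)"
  have e: "0 < e" using contr by (simp add: e_def)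
  have \<epsilon>: "0 < \<epsilon>" "\<epsilon> < 1" using e by (auto simp: \<epsilon>_def add_pos_nonneg)
  have "\<epsilon> * X < e"
  proof -
    have "\<epsilon> * (e + \<bar>X\<bar> + 1) = e" using e by (simp add: \<epsilon>_def)
    moreover have "\<epsilon> * X \<le> \<epsilon> * \<bar>X\<bar>" using \<epsilon> by simp
    moreover have "0 < \<epsilon> * (e + 1)" using \<epsilon> e by simp
    ultimately show ?thesis by (simp add: algebra_simps)
  qed
  obtain DA where DA: "\<And>x. (Gp has_real_derivative DA x) (at x)" "continuous_on UNIV DA"
      "\<And>t. t \<in> {0..1} \<Longrightarrow> DA t = slope_max F a t"
    using primitive_on_unitE[OF Gp] by blast
  obtain DB where DB: "\<And>x. (Gm has_real_derivative DB x) (at x)" "continuous_on UNIV DB"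
      "\<And>t. t \<in> {0..1} \<Longrightarrow> DB t = slope_min F a t"
    using primitive_on_unitE[OF Gm] by blast
  define u where "u \<tau> = Gp \<tau> + \<epsilon> * (Gm \<tau> - Gp \<tau>)" for \<tau>
  have du: "(u has_real_derivative DA x + \<epsilon> * (DB x - DA x)) (at x)" for x
    unfolding u_def by (auto intro!: derivative_eq_intros DA(1) DB(1))
  have C1: "u C1_differentiable_on UNIV"
    unfolding C1_differentiable_on_UNIV_iff using du
    by (intro exI[of _ "\<lambda>x. DA x + \<epsilon> * (DB x - DA x)"] conjI)
       (auto intro!: continuous_intros DA(2) DB(2))
  have "continuous_on {\<alpha>..1} (\<lambda>\<tau>. V \<tau> - u \<tau>)"
    using \<alpha> C1_differentiable_imp_continuous_on[OF C1]
    by (intro continuous_intros continuous_on_subset[OF V]) (auto intro: continuous_on_subset)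
  then obtain \<tau> where \<tau>: "\<tau> \<in> {\<alpha>..1}" "\<And>y. y \<in> {\<alpha>..1} \<Longrightarrow> V \<tau> - u \<tau> \<le> V y - u y"
    using continuous_attains_inf[of "{\<alpha>..1}" "\<lambda>\<tau>. V \<tau> - u \<tau>"] \<alpha> by auto
  have "V 1 - u 1 < V \<alpha> - u \<alpha>"
    using \<open>\<epsilon> * X < e\<close> by (simp add: u_def e_def X_def algebra_simps)
  then have "\<tau> \<noteq> \<alpha>" using \<tau>(2)[of 1] \<alpha> by auto
  then have \<tau>': "\<alpha> < \<tau>" "\<tau> \<le> 1" "\<tau> \<in> {0..1}" using \<tau>(1) \<alpha> by auto
  have "eventually (\<lambda>y. V \<tau> - u \<tau> \<le> V y - u y) (at \<tau> within {0..1})"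
    by (rule eventually_at_within_unit_open[of "{\<alpha><..}"]) (use \<tau>(2) \<tau>' in auto)
  then have "subtangent u V \<tau>" using C1 by (simp add: subtangent_def)
  then have "a \<le> F \<tau> (deriv u \<tau>)" using super[OF \<tau>'(1,2)] by (auto simp: visc_super_at_def)
  moreover have "F \<tau> (deriv u \<tau>) < a"
  proof (rule between_slopes[OF adm \<tau>'(3)])
    have eq: "deriv u \<tau> = slope_max F a \<tau> + \<epsilon> * (slope_min F a \<tau> - slope_max F a \<tau>)"
      using DERIV_imp_deriv[OF du] DA(3) DB(3) \<tau>'(3) by simp
    define g where "g = slope_max F a \<tau> - slope_min F a \<tau>"
    have g: "0 < g" using gap[OF \<tau>'(1,2)] by (simp add: g_def)
    then have "0 < \<epsilon> * g" "\<epsilon> * g < 1 * g" using \<epsilon> by (simp, intro mult_strict_right_mono) auto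
    then show "slope_min F a \<tau> < deriv u \<tau>" "deriv u \<tau> < slope_max F a \<tau>"
      unfolding eq by (auto simp: g_def algebra_simps)
  qed
  ultimately show False by simp
qed

section \<open>Propagation of contact along an arc\<close>

text \<open>A function \<open>f\<close> with the increment bounds of a subsolution lies below \<open>V\<close>, and near
  each contact point \<open>V\<close> is a supersolution and the extremal slopes differ.\<close>

locale arc_contact =
  fixes F :: "real \<Rightarrow> real \<Rightarrow> real" and a :: real and f V Gp Gm :: "real \<Rightarrow> real"
  assumes adm: "admissible F a"
    and cont_f: "continuous_on {0..1} f" and cont_V: "continuous_on {0..1} V"
    and Gp: "primitive_on_unit Gp (slope_max F a)"
    and Gm: "primitive_on_unit Gm (slope_min F a)"
    and f_le_V: "\<And>t. t \<in> {0..1} \<Longrightarrow> f t \<le> V t"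
    and increment_le: "\<And>s t. 0 \<le> s \<Longrightarrow> s \<le> t \<Longrightarrow> t \<le> 1 \<Longrightarrow> f t - f s \<le> Gp t - Gp s"
    and increment_ge: "\<And>s t. 0 \<le> s \<Longrightarrow> s \<le> t \<Longrightarrow> t \<le> 1 \<Longrightarrow> Gm t - Gm s \<le> f t - f s"
    and near_contact: "\<And>s. s \<in> {0..1} \<Longrightarrow> f s = V s \<Longrightarrow> \<exists>\<epsilon>>0. \<forall>t\<in>{0..1}. \<bar>t - s\<bar> < \<epsilon> \<longrightarrow>
      slope_min F a t < slope_max F a t \<and> (0 < t \<and> t < 1 \<longrightarrow> visc_super_at F a V t)"
begin

lemma primitive_gap:
  assumes "0 \<le> s" "s < t" "t \<le> 1"
    and "\<And>x. s \<le> x \<Longrightarrow> x \<le> t \<Longrightarrow> slope_min F a x < slope_max F a x"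
  shows "Gm t - Gm s < Gp t - Gp s"
proof -
  have "Gp s - Gm s < Gp t - Gm t"
  proof (rule DERIV_pos_imp_increasing[OF \<open>s < t\<close>])
    fix x assume x: "s \<le> x" "x \<le> t"
    then have "((\<lambda>x. Gp x - Gm x) has_real_derivative slope_max F a x - slope_min F a x) (at x)"
      using Gp Gm assms by (intro derivative_intros) (auto simp: primitive_on_unit_def)
    then show "\<exists>y. ((\<lambda>x. Gp x - Gm x) has_real_derivative y) (at x) \<and> 0 < y"
      using assms(4)[OF x] by (intro exI conjI) auto
  qed
  then show ?thesis by simp
qed

text \<open>The last conclusion of the second alternative rules out that \<open>f\<close> also has the increments of
  \<open>Gp\<close> to the right of \<open>s\<close>.\<close>

lemma interior_contact_dichotomy:
  assumes s: "0 < s" "s < 1" and contact: "f s = V s"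
  obtains \<delta> where "0 < \<delta>" "\<delta> \<le> s" "s + \<delta> \<le> 1"
      "\<forall>t\<in>{s - \<delta>..s}. f t = V t \<and> f s - f t = Gp s - Gp t"
    | \<delta> where "0 < \<delta>" "\<delta> \<le> s" "s + \<delta> \<le> 1"
      "\<forall>t\<in>{s..s + \<delta>}. f t = V t \<and> f t - f s = Gm t - Gm s"
      "\<forall>t\<in>{s<..s + \<delta>}. Gm t - Gm s < Gp t - Gp s"
proof -
  obtain \<epsilon> where \<epsilon>: "0 < \<epsilon>" "\<And>t. t \<in> {0..1} \<Longrightarrow> \<bar>t - s\<bar> < \<epsilon> \<Longrightarrow>
      slope_min F a t < slope_max F a t \<and> (0 < t \<and> t < 1 \<longrightarrow> visc_super_at F a V t)"
    using near_contact[of s] s contact by force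
  define \<delta> where "\<delta> = min (\<epsilon> / 2) (min s (1 - s))"
  have \<delta>: "0 < \<delta>" "\<delta> \<le> s" "s + \<delta> \<le> 1" "\<delta> < \<epsilon>" using \<epsilon> s by (auto simp: \<delta>_def)
  have either: "V \<alpha> - V s \<le> Gp \<alpha> - Gp s \<or> V \<beta> - V s \<le> Gm \<beta> - Gm s"
    if "s - \<delta> \<le> \<alpha>" "\<alpha> < s" "s < \<beta>" "\<beta> \<le> s + \<delta>" for \<alpha> \<beta>
  proof (rule visc_super_interior_dichotomy[OF adm cont_V Gp Gm])
    fix t assume "\<alpha> < t" "t < \<beta>"
    then have "t \<in> {0..1}" "0 < t" "t < 1" "\<bar>t - s\<bar> < \<epsilon>" using that \<delta> by auto
    then show "slope_min F a t < slope_max F a t" "visc_super_at F a V t" using \<epsilon>(2) by auto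
  qed (use that \<delta> in auto)
  show ?thesis
  proof (cases "\<forall>\<alpha>\<in>{s - \<delta>..<s}. V \<alpha> - V s \<le> Gp \<alpha> - Gp s")
    case True
    have "f t = V t \<and> f s - f t = Gp s - Gp t" if "t \<in> {s - \<delta>..s}" for t
    proof (cases "t = s")
      case False
      then have "V t - V s \<le> Gp t - Gp s" using True that by auto
      moreover have "f s - f t \<le> Gp s - Gp t" using increment_le[of t s] that \<delta> by auto
      moreover have "f t \<le> V t" using f_le_V[of t] that \<delta> by auto
      ultimately show ?thesis using contact by auto
    qed (use contact in auto)
    with that(1) \<delta> show ?thesis by blast
  next
    case False
    have "f t = V t \<and> f t - f s = Gm t - Gm s" if "t \<in> {s..s + \<delta>}" for t
    proof (cases "t = s")
      case False
      then have "V t - V s \<le> Gm t - Gm s"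
        using either[of _ t] that \<open>\<not> (\<forall>\<alpha>\<in>_. _)\<close> by force
      moreover have "Gm t - Gm s \<le> f t - f s" using increment_ge[of s t] that \<delta> by auto
      moreover have "f t \<le> V t" using f_le_V[of t] that \<delta> by auto
      ultimately show ?thesis using contact by auto
    qed (use contact in auto)
    moreover have "Gm t - Gm s < Gp t - Gp s" if "t \<in> {s<..s + \<delta>}" for t
      using that \<delta> s \<epsilon>(2) by (intro primitive_gap) auto
    ultimately show ?thesis using that(2) \<delta> by blast
  qed
qed

lemma endpoint_contact_step:
  assumes contact: "f 1 = V 1" and super: "visc_super_at F a V 1"
  obtains \<delta> where "0 < \<delta>" "\<delta> \<le> 1" "\<forall>t\<in>{1 - \<delta>..1}. f t = V t \<and> f 1 - f t = Gp 1 - Gp t"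
proof -
  obtain \<epsilon> where \<epsilon>: "0 < \<epsilon>" "\<And>t. t \<in> {0..1} \<Longrightarrow> \<bar>t - 1\<bar> < \<epsilon> \<Longrightarrow>
      slope_min F a t < slope_max F a t \<and> (0 < t \<and> t < 1 \<longrightarrow> visc_super_at F a V t)"
    using near_contact[of 1] contact by force
  define \<delta> where "\<delta> = min (\<epsilon> / 2) 1"
  have \<delta>: "0 < \<delta>" "\<delta> \<le> 1" "\<delta> < \<epsilon>" using \<epsilon> by (auto simp: \<delta>_def)
  have "f t = V t \<and> f 1 - f t = Gp 1 - Gp t" if "t \<in> {1 - \<delta>..1}" for t
  proof (cases "t = 1")
    case False
    have "V t - V 1 \<le> Gp t - Gp 1"
    proof (rule visc_super_endpoint_bound[OF adm cont_V Gp Gm])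
      fix x assume "t < x" "x \<le> 1"
      then have x: "x \<in> {0..1}" "0 < x" "\<bar>x - 1\<bar> < \<epsilon>" using that \<delta> by auto
      then show "slope_min F a x < slope_max F a x" using \<epsilon>(2) by auto
      show "visc_super_at F a V x" using \<epsilon>(2)[OF x(1,3)] x super by (cases "x = 1") auto
    qed (use that \<delta> False in auto)
    moreover have "f 1 - f t \<le> Gp 1 - Gp t" using increment_le[of t 1] that \<delta> by auto
    moreover have "f t \<le> V t" using f_le_V[of t] that \<delta> by auto
    ultimately show ?thesis using contact by auto
  qed (use contact in auto)
  with that \<delta> show ?thesis by blast
qed

text \<open>Once contact has propagated backward over a short piece it cannot turn: a forward piece
  would give \<open>f\<close> the increments of both \<open>Gp\<close> and \<open>Gm\<close>.\<close>

lemma contact_backward: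
  assumes s: "s \<le> 1" and \<delta>: "0 < \<delta>" "\<delta> \<le> s"
    and start: "\<forall>t\<in>{s - \<delta>..s}. f t = V t \<and> f s - f t = Gp s - Gp t"
    and t: "0 \<le> t" "t \<le> s"
  shows "f t = V t \<and> f s - f t = Gp s - Gp t"
proof -
  define Q where "Q t \<longleftrightarrow> f t = V t \<and> f s - f t = Gp s - Gp t" for t
  define S where "S = {t \<in> {0..s}. \<forall>x\<in>{t..s}. Q x}"
  define m where "m = Inf S"
  have "s - \<delta> \<in> {0..s}" using \<delta> by simp
  then have S0: "s - \<delta> \<in> S" using start unfolding S_def Q_def by blast
  have bdd: "bdd_below S" by (intro bdd_belowI[of _ 0]) (auto simp: S_def)
  have "\<And>x. x \<in> S \<Longrightarrow> 0 \<le> x" by (simp add: S_def)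
  then have m: "m \<le> s - \<delta>" "0 \<le> m"
    unfolding m_def using cInf_lower[OF S0 bdd] cInf_greatest[of S 0] S0 by auto
  have above: "Q t" if "m < t" "t \<le> s" for t
  proof -
    obtain y where "y \<in> S" "y < t"
      using cInf_lessD[of S t] S0 \<open>m < t\<close> unfolding m_def by auto
    then show ?thesis using that by (auto simp: S_def)
  qed
  have cl: "closure {m<..<s} = {m..s}" using m \<delta> by simp
  have "f m - V m = 0"
  proof (rule continuous_constant_on_closure[of "{m<..<s}" "\<lambda>t. f t - V t"])
    show "continuous_on (closure {m<..<s}) (\<lambda>t. f t - V t)"
      unfolding cl using m s
      by (intro continuous_intros continuous_on_subset[OF cont_f] continuous_on_subset[OF cont_V])
        auto
  qed (use above m \<delta> in \<open>auto simp: cl Q_def\<close>)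
  moreover have "f m - Gp m = f s - Gp s"
  proof (rule continuous_constant_on_closure[of "{m<..<s}" "\<lambda>t. f t - Gp t"])
    show "continuous_on (closure {m<..<s}) (\<lambda>t. f t - Gp t)"
      unfolding cl using m s
      by (intro continuous_intros continuous_on_subset[OF cont_f] primitive_on_unit_continuous[OF Gp])
        auto
    show "m \<in> closure {m<..<s}" using m \<delta> unfolding cl by simp
    fix x assume "x \<in> {m<..<s}"
    then have "Q x" using above by simp
    then show "f x - Gp x = f s - Gp s" by (simp add: Q_def)
  qed
  ultimately have Qm: "Q m" by (simp add: Q_def)
  have "m = 0"
  proof (rule ccontr)
    assume "m \<noteq> 0"
    then have m': "0 < m" "m < 1" using m s \<delta> by auto
    have "f m = V m" using Qm by (simp add: Q_def)
    with m' show False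
    proof (cases rule: interior_contact_dichotomy)
      case (1 d)
      have "m - d \<in> S"
      proof -
        have "Q x" if "x \<in> {m - d..s}" for x
        proof (cases "x \<le> m")
          case True
          then have "x \<in> {m - d..m}" using that by auto
          then have "f x = V x \<and> f m - f x = Gp m - Gp x" using 1(4) by blast
          then show ?thesis using Qm by (auto simp: Q_def)
        next
          case False
          then show ?thesis using above that by auto
        qed
        then show ?thesis using 1 m \<delta> by (auto simp: S_def)
      qed
      then have "m \<le> m - d" unfolding m_def using bdd by (rule cInf_lower)
      then show False using 1 by simp
    next
      case (2 d)
      define x where "x = min (m + d) s"
      have x: "x \<in> {m<..m + d}" "x \<le> s" "m < x" using 2 m \<delta> by (auto simp: x_def)
      then have "x \<in> {m..m + d}" by simp
      then have "f x - f m = Gm x - Gm m" using 2(4) by blast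
      moreover have "Gm x - Gm m < Gp x - Gp m" using 2(5) x(1) by blast
      moreover have "f x - f m = Gp x - Gp m"
        using above[OF x(3,2)] Qm by (simp add: Q_def)
      ultimately show False by simp
    qed
  qed
  then have "Q t" using Qm above[of t] t by (cases "t = 0") auto
  then show ?thesis by (simp add: Q_def)
qed

end

section \<open>The critical level of a network\<close>

lemma arc_hamiltonian_admissible_level:
  assumes "network_hamiltonian E H" "\<gamma> \<in> E"
  shows "\<exists>B. admissible (H \<gamma>) B \<and> (\<forall>s\<in>{0..1}. H \<gamma> s 0 \<le> B)"
proof -
  have cont: "continuous_on ({0..1} \<times> UNIV) (\<lambda>(s, \<mu>). H \<gamma> s \<mu>)"
    using assms by (simp add: network_hamiltonian_def)
  have "continuous_on {0..1} ((\<lambda>(s, \<mu>). H \<gamma> s \<mu>) \<circ> (\<lambda>s. (s, 0)))"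
    by (intro continuous_on_compose continuous_intros continuous_on_subset[OF cont]) auto
  then have "continuous_on {0..1} (\<lambda>s. H \<gamma> s 0)" by (simp add: o_def)
  then obtain x where "\<forall>y\<in>{0..1}. H \<gamma> y 0 \<le> H \<gamma> x 0"
    using continuous_attains_sup[of "{0..1::real}" "\<lambda>s. H \<gamma> s 0"] by auto
  moreover from this have "admissible (H \<gamma>) (H \<gamma> x 0)"
    using assms unfolding admissible_def network_hamiltonian_def by blast
  ultimately show ?thesis by blast
qed

lemma arc_critical_value_attained:
  assumes "network_hamiltonian E H" "\<gamma> \<in> E" "s \<in> {0..1}"
  shows "\<exists>\<mu>. H \<gamma> s \<mu> \<le> arc_critical_value (H \<gamma>)"
proof -
  \<comment> \<open>The minimum over all slopes is attained in the sublevel set of \<open>B\<close>, which is compact and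
    contains the slope 0.\<close>
  obtain B where B: "admissible (H \<gamma>) B" "\<And>s. s \<in> {0..1} \<Longrightarrow> H \<gamma> s 0 \<le> B"
    using arc_hamiltonian_admissible_level[OF assms(1,2)] by blast
  have attained: "\<exists>\<mu>. \<forall>\<mu>'. H \<gamma> t \<mu> \<le> H \<gamma> t \<mu>'" if t: "t \<in> {0..1}" for t
  proof -
    have "\<exists>\<mu>\<in>{\<mu>. H \<gamma> t \<mu> \<le> B}. \<forall>\<mu>'\<in>{\<mu>. H \<gamma> t \<mu> \<le> B}. H \<gamma> t \<mu> \<le> H \<gamma> t \<mu>'"
      using admissible_sublevel_compact[OF B(1) t]
        continuous_on_subset[OF admissible_continuous_slope[OF B(1) t]]
      by (intro continuous_attains_inf) auto
    then obtain \<mu> where \<mu>: "H \<gamma> t \<mu> \<le> B" "\<And>\<mu>'. H \<gamma> t \<mu>' \<le> B \<Longrightarrow> H \<gamma> t \<mu> \<le> H \<gamma> t \<mu>'" by blast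
    then have "H \<gamma> t \<mu> \<le> H \<gamma> t \<mu>'" for \<mu>' by (cases "H \<gamma> t \<mu>' \<le> B") auto
    then show ?thesis by blast
  qed
  have inf: "(INF \<mu>. H \<gamma> t \<mu>) = H \<gamma> t \<mu>" if "\<forall>\<mu>'. H \<gamma> t \<mu> \<le> H \<gamma> t \<mu>'" for t \<mu>
    using that by (intro cInf_eq_minimum) auto
  have "(INF \<mu>. H \<gamma> t \<mu>) \<le> B" if "t \<in> {0..1}" for t
  proof -
    obtain \<mu> where \<mu>: "\<forall>\<mu>'. H \<gamma> t \<mu> \<le> H \<gamma> t \<mu>'" using attained[OF \<open>t \<in> {0..1}\<close>] by blast
    then have "H \<gamma> t \<mu> \<le> H \<gamma> t 0" by blast
    then show ?thesis using inf[OF \<mu>] B(2)[OF \<open>t \<in> {0..1}\<close>] by linarith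
  qed
  then have bdd: "bdd_above ((\<lambda>s. INF \<mu>. H \<gamma> s \<mu>) ` {0..1})"
    by (intro bdd_aboveI2) auto
  obtain \<mu> where "\<forall>\<mu>'. H \<gamma> s \<mu> \<le> H \<gamma> s \<mu>'" using attained assms(3) by blast
  then have "H \<gamma> s \<mu> = (INF \<mu>. H \<gamma> s \<mu>)" using inf by simp
  also have "\<dots> \<le> arc_critical_value (H \<gamma>)"
    unfolding arc_critical_value_def by (rule cSUP_upper[OF assms(3) bdd])
  finally show ?thesis by blast
qed

text \<open>Constants are subsolutions at high levels, so the infimum defining the critical value is
  over a nonempty set.\<close>

lemma subsolution_exists:
  assumes "embedded_network E" "network_hamiltonian E H"
  shows "\<exists>a\<ge>min_level E H. subsolution E H a (\<lambda>_. 0)"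
proof -
  have "\<exists>B. \<forall>s\<in>{0..1}. H \<gamma> s 0 \<le> B" if "\<gamma> \<in> E" for \<gamma>
    using arc_hamiltonian_admissible_level[OF assms(2) that] by metis
  then have "\<exists>B. \<forall>\<gamma>\<in>E. \<forall>s\<in>{0..1}. H \<gamma> s 0 \<le> B \<gamma>" by (intro bchoice) blast
  then obtain B where B: "\<And>\<gamma> s. \<gamma> \<in> E \<Longrightarrow> s \<in> {0..1} \<Longrightarrow> H \<gamma> s 0 \<le> B \<gamma>" by blast
  define a where "a = max (min_level E H) (Max (B ` E))"
  have fin: "finite E" using assms(1) unfolding embedded_network_def by blast
  have "visc_sub_at (H \<gamma>) a ((\<lambda>_. 0) \<circ> \<gamma>) s" if \<gamma>: "\<gamma> \<in> E" and s: "s \<in> {0<..<1}" for \<gamma> s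
    unfolding visc_sub_at_def
  proof (intro allI impI)
    fix \<phi> assume "supertangent \<phi> ((\<lambda>_. 0) \<circ> \<gamma>) s"
    then have C1: "\<phi> C1_differentiable_on UNIV"
      and ev: "eventually (\<lambda>t. \<phi> s \<le> \<phi> t) (at s within {0..1})"
      by (auto simp: supertangent_def)
    from C1 obtain D where D: "(\<phi> has_real_derivative D) (at s)"
      unfolding C1_differentiable_on_UNIV_iff by blast
    have "eventually (\<lambda>t. \<phi> s \<le> \<phi> t) (at s)" using ev s by (simp add: at_within_Icc_at)
    then obtain d where "0 < d" "\<And>t. t \<noteq> s \<Longrightarrow> dist t s < d \<Longrightarrow> \<phi> s \<le> \<phi> t"
      unfolding eventually_at by blast
    then have "D = 0"
      using DERIV_local_min[OF D, of d] by (metis abs_minus_commute dist_real_def order_refl)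
    then have "deriv \<phi> s = 0" using D by (simp add: DERIV_imp_deriv)
    moreover have "H \<gamma> s 0 \<le> B \<gamma>" using B \<gamma> s by auto
    moreover have "B \<gamma> \<le> Max (B ` E)" using fin \<gamma> by simp
    ultimately show "H \<gamma> s (deriv \<phi> s) \<le> a" by (simp add: a_def)
  qed
  then have "subsolution E H a (\<lambda>_. 0)" by (simp add: subsolution_def)
  moreover have "min_level E H \<le> a" by (simp add: a_def)
  ultimately show ?thesis by blast
qed

lemma admissible_critical_value:
  assumes "embedded_network E" "network_hamiltonian E H" "\<gamma> \<in> E"
  shows "admissible (H \<gamma>) (critical_value E H)"
proof -
  have "min_level E H \<le> critical_value E H"
    unfolding critical_value_def using subsolution_exists[OF assms(1,2)]
    by (intro cInf_greatest) auto
  moreover have "arc_critical_value (H \<gamma>) \<le> min_level E H"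
  proof -
    have "finite E" using assms(1) unfolding embedded_network_def by blast
    then show ?thesis unfolding min_level_def using assms(3) by (intro Max_ge) auto
  qed
  ultimately have "\<exists>\<mu>. H \<gamma> s \<mu> \<le> critical_value E H" if "s \<in> {0..1}" for s
    using arc_critical_value_attained[OF assms(2,3) that] by (meson order_trans)
  then show ?thesis
    using assms(2,3) unfolding admissible_def network_hamiltonian_def by blast
qed

section \<open>Geometry of embedded networks\<close>

lemma embedded_networkD:
  assumes "embedded_network E"
  shows "finite E" "\<And>\<gamma>. \<gamma> \<in> E \<Longrightarrow> regular_simple_arc \<gamma>"
    "\<And>\<gamma>. \<gamma> \<in> E \<Longrightarrow> reversepath \<gamma> \<in> E"
    "\<And>\<gamma> \<gamma>' s t. \<gamma> \<in> E \<Longrightarrow> \<gamma>' \<in> E \<Longrightarrow> s \<in> {0<..<1} \<Longrightarrow> t \<in> {0..1} \<Longrightarrow> \<gamma> s = \<gamma>' t \<Longrightarrow>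
      \<gamma>' = \<gamma> \<or> \<gamma>' = reversepath \<gamma>"
proof -
  have n: "\<forall>\<gamma>\<in>E. regular_simple_arc \<gamma>" "\<forall>\<gamma>\<in>E. reversepath \<gamma> \<in> E"
      "\<forall>\<gamma>\<in>E. \<forall>\<gamma>'\<in>E. \<gamma>' \<noteq> \<gamma> \<and> \<gamma>' \<noteq> reversepath \<gamma> \<longrightarrow> \<gamma> ` {0<..<1} \<inter> \<gamma>' ` {0..1} = {}"
    using assms unfolding embedded_network_def by satx+
  show "finite E" using assms unfolding embedded_network_def by satx
  show "regular_simple_arc \<gamma>" "reversepath \<gamma> \<in> E" if "\<gamma> \<in> E" for \<gamma>
    using n(1,2) that by simp_all
  fix \<gamma> \<gamma>' s t
  assume *: "\<gamma> \<in> E" "\<gamma>' \<in> E" "s \<in> {0<..<1::real}" "t \<in> {0..1::real}" "\<gamma> s = \<gamma>' t"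
  then have "\<gamma> s \<in> \<gamma> ` {0<..<1}" "\<gamma> s \<in> \<gamma>' ` {0..1}" by blast+
  then have "\<gamma> ` {0<..<1} \<inter> \<gamma>' ` {0..1} \<noteq> {}" by blast
  then show "\<gamma>' = \<gamma> \<or> \<gamma>' = reversepath \<gamma>" using n(3) *(1,2) by metis
qed

lemma arc_continuous:
  assumes "embedded_network E" "\<gamma> \<in> E"
  shows "continuous_on {0..1} \<gamma>"
  using embedded_networkD(2)[OF assms]
  by (simp add: regular_simple_arc_def simple_path_def path_def)

lemma arc_in_network_space:
  assumes "\<gamma> \<in> E" "t \<in> {0..1}"
  shows "\<gamma> t \<in> network_space E"
  using assms unfolding network_space_def path_image_def by blast

lemma arc_simple:
  assumes "embedded_network E" "\<gamma> \<in> E" "s \<in> {0..1}" "t \<in> {0..1}" "\<gamma> s = \<gamma> t"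
  shows "s = t \<or> s = 0 \<and> t = 1 \<or> s = 1 \<and> t = 0"
  using embedded_networkD(2)[OF assms(1,2)] assms(3-)
  unfolding regular_simple_arc_def simple_path_def loop_free_def by blast

lemma arc_interior_unique:
  assumes net: "embedded_network E" and "\<gamma> \<in> E" "\<gamma>' \<in> E" "t \<in> {0<..<1}" "s \<in> {0..1}" "\<gamma>' s = \<gamma> t"
  shows "\<gamma>' = \<gamma> \<and> s = t \<or> \<gamma>' = reversepath \<gamma> \<and> s = 1 - t"
proof -
  consider "\<gamma>' = \<gamma>" | "\<gamma>' = reversepath \<gamma>"
    using embedded_networkD(4)[OF net] assms by metis
  then show ?thesis
  proof cases
    case 1
    then show ?thesis using arc_simple[OF net \<open>\<gamma> \<in> E\<close>, of s t] assms by auto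
  next
    case 2
    then have "\<gamma> (1 - s) = \<gamma> t" using assms by (simp add: reversepath_def)
    then show ?thesis using arc_simple[OF net \<open>\<gamma> \<in> E\<close>, of "1 - s" t] assms 2 by auto
  qed
qed

lemma arc_interior_not_vertex:
  assumes net: "embedded_network E" and \<gamma>: "\<gamma> \<in> E" "t \<in> {0<..<1}"
  shows "\<gamma> t \<notin> vertices E"
proof
  assume "\<gamma> t \<in> vertices E"
  then obtain \<gamma>' where \<gamma>': "\<gamma>' \<in> E" "\<gamma>' 0 = \<gamma> t \<or> \<gamma>' 1 = \<gamma> t"
    unfolding vertices_def pathstart_def pathfinish_def by auto
  then obtain s :: real where s: "\<gamma>' \<in> E" "s = 0 \<or> s = 1" "\<gamma>' s = \<gamma> t" by blast
  then have "s \<in> {0..1}" by auto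
  from arc_interior_unique[OF net \<gamma>(1) s(1) \<gamma>(2) this s(3)] s(2) \<gamma>(2) show False by auto
qed

lemma arc_has_velocity:
  assumes "embedded_network E" "\<gamma> \<in> E" "t \<in> {0..1}"
  shows "(\<gamma> has_vector_derivative arc_velocity \<gamma> t) (at t within {0..1})"
  using embedded_networkD(2)[OF assms(1,2)] assms(3)
  by (simp add: regular_simple_arc_def arc_velocity_def vector_derivative_works)

lemma arc_has_velocity_interior:
  assumes "embedded_network E" "\<gamma> \<in> E" "t \<in> {0<..<1}"
  shows "(\<gamma> has_vector_derivative arc_velocity \<gamma> t) (at t)"
  using arc_has_velocity[OF assms(1,2), of t] assms(3) by (simp add: at_within_Icc_at)

lemma arc_velocity_nonzero:
  assumes "embedded_network E" "\<gamma> \<in> E" "t \<in> {0..1}"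
  shows "arc_velocity \<gamma> t \<noteq> 0"
  using embedded_networkD(2)[OF assms(1,2)] assms(3) by (simp add: regular_simple_arc_def)

lemma arc_velocity_reversepath:
  assumes "embedded_network E" "\<gamma> \<in> E" "t \<in> {0<..<1}"
  shows "arc_velocity (reversepath \<gamma>) t = - arc_velocity \<gamma> (1 - t)"
proof -
  have "((\<lambda>x::real. 1 - x) has_vector_derivative - 1) (at t)"
    by (auto intro!: derivative_eq_intros simp: has_real_derivative_iff_has_vector_derivative[symmetric])
  from vector_diff_chain_at[OF this, of \<gamma> "arc_velocity \<gamma> (1 - t)"]
  have "(reversepath \<gamma> has_vector_derivative - arc_velocity \<gamma> (1 - t)) (at t)"
    using arc_has_velocity_interior[OF assms(1,2), of "1 - t"] assms(3)
    by (simp add: o_def reversepath_def)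
  moreover have "(reversepath \<gamma> has_vector_derivative arc_velocity (reversepath \<gamma>) t) (at t)"
    using assms by (intro arc_has_velocity_interior embedded_networkD(3))
  ultimately show ?thesis by (rule vector_derivative_unique_at[rotated])
qed

lemma arc_lipschitz:
  assumes "embedded_network E" "\<gamma> \<in> E"
  shows "\<exists>L\<ge>0. L-lipschitz_on {0..1} \<gamma>"
proof -
  have "continuous_on {0..1} (arc_velocity \<gamma>)"
    using embedded_networkD(2)[OF assms] by (simp add: regular_simple_arc_def)
  then have "bounded (arc_velocity \<gamma> ` {0..1})"
    by (intro compact_imp_bounded compact_continuous_image) auto
  then obtain L where L: "0 < L" "\<And>t. t \<in> {0..1} \<Longrightarrow> norm (arc_velocity \<gamma> t) \<le> L"
    by (auto simp: bounded_pos)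
  have "L-lipschitz_on {0..1} \<gamma>"
  proof (rule bounded_derivative_imp_lipschitz)
    fix t :: real assume t: "t \<in> {0..1}"
    show "(\<gamma> has_derivative (\<lambda>h. h *\<^sub>R arc_velocity \<gamma> t)) (at t within {0..1})"
      using arc_has_velocity[OF assms t] by (simp add: has_vector_derivative_def)
    show "onorm (\<lambda>h. h *\<^sub>R arc_velocity \<gamma> t) \<le> L"
    proof (rule onorm_le)
      fix h
      show "norm (h *\<^sub>R arc_velocity \<gamma> t) \<le> L * norm h"
        using mult_left_mono[OF L(2)[OF t], of "\<bar>h\<bar>"] by (simp add: mult.commute)
    qed
  qed (use L in auto)
  then show ?thesis using L by (intro exI[of _ L]) auto
qed

lemma network_space_compact:
  assumes "embedded_network E"
  shows "compact (network_space E)"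
  unfolding network_space_def
proof (rule compact_UN)
  show "finite E" using embedded_networkD(1)[OF assms] .
  fix \<gamma> assume "\<gamma> \<in> E"
  then show "compact (path_image \<gamma>)"
    using embedded_networkD(2)[OF assms]
    by (intro compact_path_image) (auto simp: regular_simple_arc_def simple_path_def)
qed

lemma network_space_cases:
  assumes "x \<in> network_space E"
  obtains "x \<in> vertices E" | \<gamma> t where "\<gamma> \<in> E" "t \<in> {0<..<1}" "x = \<gamma> t"
proof -
  obtain \<gamma> t where t: "\<gamma> \<in> E" "t \<in> {0..1}" "x = \<gamma> t"
    using assms by (auto simp: network_space_def path_image_def)
  show ?thesis
  proof (cases "t = 0 \<or> t = 1")
    case True
    then have "x \<in> vertices E"
      using t by (auto simp: vertices_def pathstart_def pathfinish_def)
    then show ?thesis by (rule that(1))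
  next
    case False
    then have "t \<in> {0<..<1}" using t(2) by auto
    then show ?thesis using that(2) t(1,3) by blast
  qed
qed

lemma vertices_finite:
  assumes "embedded_network E"
  shows "finite (vertices E)"
  using embedded_networkD(1)[OF assms] by (simp add: vertices_def)

lemma slope_max_reversepath:
  assumes "network_hamiltonian E H" "\<gamma> \<in> E" "s \<in> {0..1}"
  shows "slope_max (H (reversepath \<gamma>)) a s = - slope_min (H \<gamma>) a (1 - s)"
proof -
  have "\<forall>\<mu>. H (reversepath \<gamma>) s \<mu> = reversed (H \<gamma>) s \<mu>"
    using assms unfolding network_hamiltonian_def reversed_def by blast
  then have "slope_max (H (reversepath \<gamma>)) a s = slope_max (reversed (H \<gamma>)) a s"
    by (simp add: slope_max_def)
  then show ?thesis by (simp add: slope_max_reversed)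
qed

text \<open>On an arc traversed with its own velocity the support function is the maximal slope.  The
  supremum in \<^const>\<open>sigma\<close> is over the two parametrisations of the point, which agree.\<close>

lemma sigma_arc_interior:
  assumes net: "embedded_network E" and ham: "network_hamiltonian E H"
    and \<gamma>: "\<gamma> \<in> E" "t \<in> {0<..<1}" and adm: "admissible (H \<gamma>) a"
  shows "sigma E H a (\<gamma> t) (arc_velocity \<gamma> t) = ereal (slope_max (H \<gamma>) a t)"
proof -
  let ?q = "arc_velocity \<gamma> t"
  have t: "t \<in> {0..1}" "1 - t \<in> {0..1}" "1 - t \<in> {0<..<1}" using \<gamma>(2) by auto
  have q: "?q \<bullet> ?q / (norm ?q)\<^sup>2 = 1"
    using arc_velocity_nonzero[OF net \<gamma>(1) t(1)] by (simp add: power2_norm_eq_inner)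
  have fwd: "arc_support \<gamma> (H \<gamma>) a t ?q = ereal (slope_max (H \<gamma>) a t)"
    using sigma_plus_eq_slope_max[OF adm t(1)] unfolding arc_support_def sigma_plus_def q by simp
  have vel: "arc_velocity (reversepath \<gamma>) (1 - t) = - ?q"
    using arc_velocity_reversepath[OF net \<gamma>(1) t(3)] by simp
  have hr: "H (reversepath \<gamma>) (1 - t) \<mu> = H \<gamma> t (- \<mu>)" for \<mu>
    using ham \<gamma>(1) t(2) by (simp add: network_hamiltonian_def)
  have "(\<lambda>\<mu>. ereal (\<mu> * (?q \<bullet> - ?q / (norm (- ?q))\<^sup>2))) ` {\<mu>. H \<gamma> t (- \<mu>) = a}
      = ereal ` {\<mu>. H \<gamma> t \<mu> = a}"
    using q by (force intro: image_eqI[where x = "- x" for x])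
  then have bwd: "arc_support (reversepath \<gamma>) (H (reversepath \<gamma>)) a (1 - t) ?q
      = ereal (slope_max (H \<gamma>) a t)"
    using sigma_plus_eq_slope_max[OF adm t(1)]
    unfolding arc_support_def sigma_plus_def vel hr by simp
  have "{arc_support \<gamma>' (H \<gamma>') a s ?q | \<gamma>' s. \<gamma>' \<in> E \<and> s \<in> {0<..<1} \<and> \<gamma>' s = \<gamma> t}
      = {ereal (slope_max (H \<gamma>) a t)}"
  proof (intro equalityI subsetI)
    fix z assume "z \<in> {arc_support \<gamma>' (H \<gamma>') a s ?q | \<gamma>' s. \<gamma>' \<in> E \<and> s \<in> {0<..<1} \<and> \<gamma>' s = \<gamma> t}"
    then obtain \<gamma>' s where z: "z = arc_support \<gamma>' (H \<gamma>') a s ?q"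
      and s: "\<gamma>' \<in> E" "s \<in> {0<..<1}" "\<gamma>' s = \<gamma> t" by blast
    have "s \<in> {0..1}" using s(2) by auto
    from arc_interior_unique[OF net \<gamma>(1) s(1) \<gamma>(2) this s(3)]
    show "z \<in> {ereal (slope_max (H \<gamma>) a t)}" using z fwd bwd by auto
  qed (use \<gamma> fwd[symmetric] in blast)
  then show ?thesis using arc_interior_not_vertex[OF net \<gamma>] unfolding sigma_def by simp
qed

section \<open>Closed chains of arcs\<close>

text \<open>The concatenation of arcs \<open>\<eta> 0, \<dots>, \<eta> (k - 1)\<close>, each run through in unit time.\<close>

definition chain_curve :: "(nat \<Rightarrow> real \<Rightarrow> 'a::euclidean_space) \<Rightarrow> nat \<Rightarrow> real \<Rightarrow> 'a" where
  "chain_curve \<eta> k \<tau> =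
     (if \<tau> < real k then \<eta> (nat \<lfloor>\<tau>\<rfloor>) (\<tau> - of_int \<lfloor>\<tau>\<rfloor>) else \<eta> (k - 1) 1)"

text \<open>A closed chain of arcs that visits distinct vertices and never turns back.\<close>

locale closed_chain =
  fixes E :: "(real \<Rightarrow> 'a::euclidean_space) set" and \<eta> :: "nat \<Rightarrow> real \<Rightarrow> 'a" and k :: nat
  assumes net: "embedded_network E" and k: "0 < k"
    and arcs: "\<And>i. i < k \<Longrightarrow> \<eta> i \<in> E"
    and joins: "\<And>i. Suc i < k \<Longrightarrow> \<eta> i 1 = \<eta> (Suc i) 0"
    and closes: "\<eta> (k - 1) 1 = \<eta> 0 0"
    and distinct: "inj_on (\<lambda>i. \<eta> i 0) {..<k}"
    and no_return: "\<And>i j. i < k \<Longrightarrow> j < k \<Longrightarrow> i \<noteq> j \<Longrightarrow> \<eta> i \<noteq> reversepath (\<eta> j)"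
begin

abbreviation \<xi> :: "real \<Rightarrow> 'a" where "\<xi> \<equiv> chain_curve \<eta> k"

lemma curve_on_piece:
  assumes "i < k" "real i \<le> \<tau>" "\<tau> \<le> real i + 1"
  shows "\<xi> \<tau> = \<eta> i (\<tau> - real i)"
proof (cases "\<tau> = real i + 1")
  case False
  then have "\<lfloor>\<tau>\<rfloor> = int i" using assms by (intro floor_unique) auto
  moreover have "\<tau> < real k" using assms False by linarith
  ultimately show ?thesis by (simp add: chain_curve_def)
next
  case True
  show ?thesis
  proof (cases "Suc i < k")
    case True
    then have "\<tau> < real k" using \<open>\<tau> = _\<close> by linarith
    moreover have fl: "\<lfloor>\<tau>\<rfloor> = int (Suc i)" using \<open>\<tau> = _\<close> by (intro floor_unique) auto
    moreover have "nat \<lfloor>\<tau>\<rfloor> = Suc i" unfolding fl by (rule nat_int)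
    ultimately have "\<xi> \<tau> = \<eta> (Suc i) 0" using \<open>\<tau> = _\<close> by (simp add: chain_curve_def)
    then show ?thesis using joins[OF True] \<open>\<tau> = _\<close> by simp
  next
    case False
    then have "k = Suc i" using assms by simp
    then show ?thesis using \<open>\<tau> = _\<close> by (simp add: chain_curve_def)
  qed
qed

lemma piece_cases:
  assumes "0 \<le> \<tau>" "\<tau> < real k"
  obtains i where "i < k" "real i \<le> \<tau>" "\<tau> < real i + 1"
proof
  show "nat \<lfloor>\<tau>\<rfloor> < k" using assms by (simp add: nat_less_iff floor_less_iff)
  show "real (nat \<lfloor>\<tau>\<rfloor>) \<le> \<tau>" "\<tau> < real (nat \<lfloor>\<tau>\<rfloor>) + 1" using assms by linarith+
qed

lemma closed_piece_cases:
  assumes "0 \<le> \<tau>" "\<tau> \<le> real k"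
  obtains i where "i < k" "real i \<le> \<tau>" "\<tau> \<le> real i + 1"
proof (cases "\<tau> = real k")
  case True
  then show ?thesis using that[of "k - 1"] k by (simp add: of_nat_diff)
next
  case False
  then obtain i where "i < k" "real i \<le> \<tau>" "\<tau> < real i + 1"
    using piece_cases[of \<tau>] assms by auto
  then show ?thesis using that[of i] by auto
qed

lemma curve_image: "\<xi> ` {0..real k} = (\<Union>i<k. \<eta> i ` {0..1})"
proof (intro equalityI subsetI)
  fix x assume "x \<in> \<xi> ` {0..real k}"
  then obtain \<tau> where \<tau>: "0 \<le> \<tau>" "\<tau> \<le> real k" "x = \<xi> \<tau>" by auto
  from \<tau>(1,2) obtain i where "i < k" "real i \<le> \<tau>" "\<tau> \<le> real i + 1"
    by (rule closed_piece_cases)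
  then show "x \<in> (\<Union>i<k. \<eta> i ` {0..1})"
    using curve_on_piece[of i \<tau>] \<tau>(3) by (auto intro!: bexI[of _ i] image_eqI[of _ _ "\<tau> - real i"])
next
  fix x assume "x \<in> (\<Union>i<k. \<eta> i ` {0..1})"
  then obtain i t where i: "i < k" "0 \<le> t" "t \<le> 1" "x = \<eta> i t" by auto
  then have "x = \<xi> (real i + t)" using curve_on_piece[of i "real i + t"] by simp
  moreover have "real i + t \<in> {0..real k}" using i by auto
  ultimately show "x \<in> \<xi> ` {0..real k}" by blast
qed

lemma curve_lipschitz: "\<exists>L\<ge>0. L-lipschitz_on {0..real k} \<xi>"
proof -
  have "\<forall>i\<in>{..<k}. \<exists>L. 0 \<le> L \<and> L-lipschitz_on {0..1} (\<eta> i)"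
    using arc_lipschitz[OF net arcs] by auto
  then obtain L where L: "\<And>i. i < k \<Longrightarrow> 0 \<le> L i \<and> (L i)-lipschitz_on {0..1} (\<eta> i)"
    by (auto dest!: bchoice)
  define M where "M = sum L {..<k}"
  have LM: "L i \<le> M" if "i < k" for i
    unfolding M_def using that L by (intro member_le_sum) auto
  have M: "0 \<le> M" unfolding M_def using L by (intro sum_nonneg) auto
  have "M-lipschitz_on {0..real k} \<xi>"
  proof (rule lipschitz_on_closed_Union[where I = "{..<k}" and U = "\<lambda>i. {real i..real i + 1}"])
    fix i assume "i \<in> {..<k}"
    then have i: "i < k" by simp
    show "M-lipschitz_on {real i..real i + 1} \<xi>"
    proof (rule lipschitz_onI[OF _ M])
      fix x y assume xy: "x \<in> {real i..real i + 1}" "y \<in> {real i..real i + 1}"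
      have "dist (\<xi> x) (\<xi> y) = dist (\<eta> i (x - real i)) (\<eta> i (y - real i))"
        using curve_on_piece[OF i] xy by simp
      also have "\<dots> \<le> L i * dist (x - real i) (y - real i)"
        using L[OF i] xy by (intro lipschitz_onD[of "L i" "{0..1}"]) auto
      also have "\<dots> \<le> M * dist x y"
        using LM[OF i] by (simp add: dist_real_def mult_right_mono)
      finally show "dist (\<xi> x) (\<xi> y) \<le> M * dist x y" .
    qed
  next
    show "{0..real k} \<subseteq> (\<Union>i\<in>{..<k}. {real i..real i + 1})"
    proof
      fix \<tau> assume "\<tau> \<in> {0..real k}"
      then have "0 \<le> \<tau>" "\<tau> \<le> real k" by auto
      then obtain i where "i < k" "real i \<le> \<tau>" "\<tau> \<le> real i + 1" by (rule closed_piece_cases)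
      then show "\<tau> \<in> (\<Union>i\<in>{..<k}. {real i..real i + 1})" by auto
    qed
  qed (use M in auto)
  then show ?thesis using M by blast
qed

lemma curve_vertex_distinct:
  assumes "i < k" "j < k" "\<eta> i 0 = \<eta> j 0"
  shows "i = j"
  using distinct assms by (auto dest: inj_onD)

lemma curve_injective: "inj_on \<xi> {0..<real k}"
proof (rule inj_onI)
  fix x y assume xy: "x \<in> {0..<real k}" "y \<in> {0..<real k}" "\<xi> x = \<xi> y"
  obtain i where i: "i < k" "real i \<le> x" "x < real i + 1" using piece_cases[of x] xy by auto
  obtain j where j: "j < k" "real j \<le> y" "y < real j + 1" using piece_cases[of y] xy by auto
  define s t where "s = x - real i" and "t = y - real j"
  have s: "s \<in> {0..1}" "s < 1" and t: "t \<in> {0..1}" "t < 1" using i j by (auto simp: s_def t_def)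
  have eq: "\<eta> i s = \<eta> j t"
    using xy(3) curve_on_piece[of i x] curve_on_piece[of j y] i j by (simp add: s_def t_def)
  have aux: "j = i \<and> t = s"
    if "i < k" "j < k" "s \<in> {0<..<1}" "t \<in> {0..1}" "\<eta> i s = \<eta> j t" for i j s t
  proof -
    have "\<eta> j = \<eta> i \<and> t = s \<or> \<eta> j = reversepath (\<eta> i) \<and> t = 1 - s"
      using arc_interior_unique[OF net arcs arcs, of i j s t] that by simp
    moreover have "i = j" if "\<eta> j = \<eta> i"
      using curve_vertex_distinct[of i j] \<open>i < k\<close> \<open>j < k\<close> that by simp
    moreover have "j = i" if "\<eta> j = reversepath (\<eta> i)"
      using no_return[of j i] \<open>i < k\<close> \<open>j < k\<close> that by blast
    moreover have "t = s" if "j = i"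
      using arc_simple[OF net arcs[OF \<open>i < k\<close>], of s t] \<open>\<eta> i s = \<eta> j t\<close> \<open>s \<in> _\<close> \<open>t \<in> _\<close> that
      by auto
    ultimately show ?thesis by blast
  qed
  have "i = j \<and> s = t"
  proof (cases "s = 0")
    case False
    then show ?thesis using aux[of i j s t] i j s t eq by auto
  next
    case s0: True
    show ?thesis
    proof (cases "t = 0")
      case True
      then show ?thesis using s0 eq curve_vertex_distinct i j by auto
    next
      case False
      then show ?thesis using aux[of j i t s] i j s t eq by auto
    qed
  qed
  then show "x = y" by (simp add: s_def t_def)
qed

lemma curve_abs_continuous: "abs_continuous_on_interval 0 (real k) \<xi>"
  unfolding abs_continuous_on_interval_def
proof (intro allI impI)
  fix \<epsilon> :: real assume \<epsilon>: "0 < \<epsilon>"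
  obtain L where L: "0 \<le> L" "L-lipschitz_on {0..real k} \<xi>" using curve_lipschitz by blast
  have "(\<Sum>i<n. dist (\<xi> (l i)) (\<xi> (r i))) < \<epsilon>"
    if lr: "\<forall>i<n. 0 \<le> l i \<and> l i \<le> r i \<and> r i \<le> real k" and small: "(\<Sum>i<n. r i - l i) < \<epsilon> / (L + 1)"
    for n :: nat and l r
  proof -
    have "(\<Sum>i<n. dist (\<xi> (l i)) (\<xi> (r i))) \<le> (\<Sum>i<n. L * (r i - l i))"
    proof (rule sum_mono)
      fix i assume "i \<in> {..<n}"
      then have "0 \<le> l i" "l i \<le> r i" "r i \<le> real k" using lr by auto
      then show "dist (\<xi> (l i)) (\<xi> (r i)) \<le> L * (r i - l i)"
        using lipschitz_onD[OF L(2), of "l i" "r i"] by (simp add: dist_real_def)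
    qed
    also have "\<dots> = L * (\<Sum>i<n. r i - l i)" by (simp add: sum_distrib_left)
    also have "\<dots> \<le> L * (\<epsilon> / (L + 1))" using small L by (intro mult_left_mono) auto
    also have "\<dots> < \<epsilon>" using L \<epsilon> by (simp add: field_simps)
    finally show ?thesis .
  qed
  moreover have "0 < \<epsilon> / (L + 1)" using L \<epsilon> by simp
  ultimately show "\<exists>\<delta>>0. \<forall>(n::nat) l r.
        (\<forall>i<n. 0 \<le> l i \<and> l i \<le> r i \<and> r i \<le> real k) \<and>
        (\<forall>i<n. \<forall>j<n. i \<noteq> j \<longrightarrow> {l i<..<r i} \<inter> {l j<..<r j} = {}) \<and>
        (\<Sum>i<n. r i - l i) < \<delta>
        \<longrightarrow> (\<Sum>i<n. dist (\<xi> (l i)) (\<xi> (r i))) < \<epsilon>"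
    by (intro exI[of _ "\<epsilon> / (L + 1)"]) blast
qed

lemma curve_closed: "\<xi> 0 = \<xi> (real k)"
  using curve_on_piece[of 0 0] k closes by (simp add: chain_curve_def)

lemma closed_simple_chain_curve: "closed_simple_curve E (real k) \<xi>"
  unfolding closed_simple_curve_def network_curve_def
proof (intro conjI)
  show "\<xi> ` {0..real k} \<subseteq> network_space E"
    unfolding curve_image using arc_in_network_space[OF arcs] by auto
qed (use k curve_abs_continuous curve_closed curve_injective in auto)

lemma curve_integrand_piece:
  assumes ham: "network_hamiltonian E H" and adm: "admissible (H (\<eta> i)) a"
    and i: "i < k" "real i < \<tau>" "\<tau> < real i + 1"
  shows "curve_integrand E H a (real k) \<xi> \<tau> = slope_max (H (\<eta> i)) a (\<tau> - real i)"
proof -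
  have t: "\<tau> - real i \<in> {0<..<1}" using i by auto
  have "((\<lambda>x. x - real i) has_vector_derivative 1) (at \<tau>)"
    by (auto intro!: derivative_eq_intros simp: has_real_derivative_iff_has_vector_derivative[symmetric])
  from vector_diff_chain_at[OF this arc_has_velocity_interior[OF net arcs[OF i(1)] t]]
  have "((\<lambda>x. \<eta> i (x - real i)) has_vector_derivative arc_velocity (\<eta> i) (\<tau> - real i)) (at \<tau>)"
    by (simp add: o_def)
  then have "(\<xi> has_vector_derivative arc_velocity (\<eta> i) (\<tau> - real i)) (at \<tau>)"
    by (rule has_vector_derivative_transform_within_open[where S = "{real i<..<real i + 1}"])
      (use i in \<open>auto simp: curve_on_piece\<close>)
  moreover have "at \<tau> within {0..real k} = at \<tau>"
    using i by (intro at_within_Icc_at) linarith+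
  ultimately have "vector_derivative \<xi> (at \<tau> within {0..real k}) = arc_velocity (\<eta> i) (\<tau> - real i)"
    by (simp add: vector_derivative_at)
  moreover have "\<xi> \<tau> = \<eta> i (\<tau> - real i)" using i by (intro curve_on_piece) auto
  ultimately show ?thesis
    using sigma_arc_interior[where H = H and \<gamma> = "\<eta> i", OF net ham arcs[OF i(1)] t adm]
    by (simp add: curve_integrand_def)
qed

text \<open>If a continuous function on the network has the maximal slope along every arc of the
  chain, then the length of the chain is the total increment of that function, which vanishes on
  a closed curve.\<close>

lemma curve_integral_zero:
  assumes ham: "network_hamiltonian E H" and adm: "\<And>i. i < k \<Longrightarrow> admissible (H (\<eta> i)) a"
    and w: "continuous_on (network_space E) w"
    and slope: "\<And>i t. i < k \<Longrightarrow> t \<in> {0<..<1} \<Longrightarrow>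
      ((\<lambda>t. w (\<eta> i t)) has_real_derivative slope_max (H (\<eta> i)) a t) (at t)"
  shows "set_integrable lebesgue {0..real k} (curve_integrand E H a (real k) \<xi>)"
    and "(LINT \<tau>:{0..real k}|lebesgue. curve_integrand E H a (real k) \<xi> \<tau>) = 0"
proof -
  let ?g = "curve_integrand E H a (real k) \<xi>"
  let ?S = "real ` {..k}"
  obtain L where "L-lipschitz_on {0..real k} \<xi>" using curve_lipschitz by blast
  then have "continuous_on {0..real k} \<xi>" by (rule lipschitz_on_continuous_on)
  moreover have "\<xi> ` {0..real k} \<subseteq> network_space E"
    using closed_simple_chain_curve by (simp add: closed_simple_curve_def network_curve_def)
  ultimately have cont: "continuous_on {0..real k} (\<lambda>\<tau>. w (\<xi> \<tau>))"
    by (intro continuous_on_compose2[OF w])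
  have piece: "\<exists>i<k. real i < \<tau> \<and> \<tau> < real i + 1" if "\<tau> \<in> {0..real k} - ?S" for \<tau>
  proof -
    have "0 \<le> \<tau>" "\<tau> \<le> real k" "\<tau> \<notin> ?S" using that by auto
    moreover have "real k \<in> ?S" by simp
    ultimately have "\<tau> < real k" by (metis order_le_less)
    then obtain i where i: "i < k" "real i \<le> \<tau>" "\<tau> < real i + 1"
      using piece_cases \<open>0 \<le> \<tau>\<close> by blast
    then have "real i \<in> ?S" by simp
    then have "real i \<noteq> \<tau>" using \<open>\<tau> \<notin> ?S\<close> by blast
    then show ?thesis using i by (intro exI[of _ i]) auto
  qed
  have "(?g has_integral w (\<xi> (real k)) - w (\<xi> 0)) {0..real k}"
  proof (rule fundamental_theorem_of_calculus_interior_strong[where S = ?S])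
    fix \<tau> assume "\<tau> \<in> {0<..<real k} - ?S"
    then obtain i where i: "i < k" "real i < \<tau>" "\<tau> < real i + 1" using piece[of \<tau>] by auto
    have "((\<lambda>x. x - real i) has_real_derivative 1) (at \<tau>)"
      by (auto intro!: derivative_eq_intros)
    moreover have "\<tau> - real i \<in> {0<..<1}" using i by auto
    ultimately have "((\<lambda>x. w (\<eta> i (x - real i))) has_real_derivative
        slope_max (H (\<eta> i)) a (\<tau> - real i) * 1) (at \<tau>)"
      by (intro DERIV_chain2[OF slope[OF i(1)]])
    then have "((\<lambda>x. w (\<eta> i (x - real i))) has_real_derivative ?g \<tau>) (at \<tau>)"
      using curve_integrand_piece[where H = H and i = i, OF ham adm[OF i(1)] i] by simp
    then have "((\<lambda>x. w (\<xi> x)) has_real_derivative ?g \<tau>) (at \<tau>)"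
      by (rule has_field_derivative_transform_within_open[where S = "{real i<..<real i + 1}"])
        (use i in \<open>auto simp: curve_on_piece\<close>)
    then show "((\<lambda>x. w (\<xi> x)) has_vector_derivative ?g \<tau>) (at \<tau>)"
      by (simp add: has_real_derivative_iff_has_vector_derivative)
  qed (use cont in auto)
  then have int: "(?g has_integral 0) {0..real k}" by (simp add: curve_closed)
  have "?g ` {0..real k} \<subseteq> (\<Union>i<k. slope_max (H (\<eta> i)) a ` {0..1}) \<union> ?g ` ?S"
  proof
    fix y assume "y \<in> ?g ` {0..real k}"
    then obtain \<tau> where \<tau>: "\<tau> \<in> {0..real k}" "y = ?g \<tau>" by blast
    show "y \<in> (\<Union>i<k. slope_max (H (\<eta> i)) a ` {0..1}) \<union> ?g ` ?S"
    proof (cases "\<tau> \<in> ?S")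
      case True
      then show ?thesis using \<tau>(2) by blast
    next
      case False
      then obtain i where i: "i < k" "real i < \<tau>" "\<tau> < real i + 1" using piece[of \<tau>] \<tau>(1) by auto
      then have "y = slope_max (H (\<eta> i)) a (\<tau> - real i)"
        using curve_integrand_piece[where H = H and i = i, OF ham adm[OF i(1)] i] \<tau>(2) by simp
      moreover have "\<tau> - real i \<in> {0..1}" using i by auto
      ultimately show ?thesis using i(1) by blast
    qed
  qed
  moreover have "bounded ((\<Union>i<k. slope_max (H (\<eta> i)) a ` {0..1}) \<union> ?g ` ?S)"
  proof -
    have "bounded (slope_max (H (\<eta> i)) a ` {0..1})" if "i < k" for i
      using continuous_on_slope_max[OF adm[OF that]]
      by (intro compact_imp_bounded compact_continuous_image) auto
    then have "bounded (\<Union>i<k. slope_max (H (\<eta> i)) a ` {0..1})" by (intro bounded_UN) auto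
    moreover have "bounded (?g ` ?S)" by (intro finite_imp_bounded) auto
    ultimately show ?thesis by simp
  qed
  ultimately have "bounded (?g ` {0..real k})" by (rule bounded_subset[rotated])
  then obtain B where B: "\<forall>y\<in>?g ` {0..real k}. norm y \<le> B" unfolding bounded_iff by blast
  show si: "set_integrable lebesgue {0..real k} ?g"
  proof (rule measurable_bounded_by_integrable_imp_absolutely_integrable[where g = "\<lambda>_. B"])
    show "?g \<in> borel_measurable (lebesgue_on {0..real k})"
      using int by (intro integrable_imp_measurable) auto
  qed (use B in auto)
  show "(LINT \<tau>:{0..real k}|lebesgue. ?g \<tau>) = 0"
    using set_lebesgue_integral_eq_integral(2)[OF si] int by (simp add: integral_unique)
qed

end

section \<open>The contact set of a subsolution below a supersolution\<close>

text \<open>The subsolution \<open>w\<close> is lowered by \<open>M\<close> until it lies below \<open>v\<close>, strictly so on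
  \<open>\<Gamma>'\<close>; the contact set, where the two agree, will turn out to be empty.\<close>

locale network_contact =
  fixes E :: "(real \<Rightarrow> 'a::euclidean_space) set"
    and H :: "(real \<Rightarrow> 'a) \<Rightarrow> real \<Rightarrow> real \<Rightarrow> real"
    and \<Gamma>' :: "'a set" and v w :: "'a \<Rightarrow> real" and M :: real
  assumes net: "embedded_network E"
    and ham: "network_hamiltonian E H"
    and closed_off: "closedin (top_of_set (network_space E)) \<Gamma>'"
    and aubry: "aubry_set E H \<subseteq> \<Gamma>'"
    and super: "supersolution_in E H (critical_value E H) (network_space E - \<Gamma>') v"
    and sub: "subsolution E H (critical_value E H) w"
    and below: "\<And>x. x \<in> network_space E \<Longrightarrow> w x - M \<le> v x"
    and strictly_below: "\<And>x. x \<in> \<Gamma>' \<Longrightarrow> w x - M < v x"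
begin

abbreviation c :: real where "c \<equiv> critical_value E H"

definition contact :: "'a set" where
  "contact = {x \<in> network_space E. w x - M = v x}"

lemma contact_not_in: "x \<in> contact \<Longrightarrow> x \<notin> \<Gamma>'"
  using strictly_below by (force simp: contact_def)

lemma adm: "\<gamma> \<in> E \<Longrightarrow> admissible (H \<gamma>) c"
  by (rule admissible_critical_value[OF net ham])

lemma slopes_differ:
  assumes "\<gamma> \<in> E" "t \<in> {0..1}" "\<gamma> t \<notin> \<Gamma>'"
  shows "slope_min (H \<gamma>) c t < slope_max (H \<gamma>) c t"
proof (rule ccontr)
  assume "\<not> ?thesis"
  then have "slope_max (H \<gamma>) c t = slope_min (H \<gamma>) c t"
    using slope_min_le_max[OF adm[OF assms(1)] assms(2)] by simp
  then have "sigma_plus (H \<gamma>) c t = sigma_minus (H \<gamma>) c t"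
    using sigma_plus_eq_slope_max[OF adm[OF assms(1)] assms(2)]
      sigma_minus_eq_slope_min[OF adm[OF assms(1)] assms(2)] by simp
  then have "\<gamma> t \<in> aubry_set E H" unfolding aubry_set_def using assms(1,2) by blast
  then show False using aubry assms(3) by blast
qed

lemma slope_min_reversepath:
  assumes "\<gamma> \<in> E" "s \<in> {0..1}"
  shows "slope_min (H (reversepath \<gamma>)) c s = - slope_max (H \<gamma>) c (1 - s)"
  using slope_max_reversepath[OF ham embedded_networkD(3)[OF net assms(1)], of "1 - s"] assms(2)
  by simp

lemma off_neighbourhood:
  assumes \<gamma>: "\<gamma> \<in> E" and s: "s \<in> {0..1}" "\<gamma> s \<notin> \<Gamma>'"
  shows "\<exists>\<epsilon>>0. \<forall>t\<in>{0..1}. \<bar>t - s\<bar> < \<epsilon> \<longrightarrow> \<gamma> t \<notin> \<Gamma>'"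
proof -
  have "closedin (top_of_set {0..1}) ({0..1} \<inter> \<gamma> -` \<Gamma>')"
    using arc_in_network_space[OF \<gamma>]
    by (intro continuous_closedin_preimage_gen[OF arc_continuous[OF net \<gamma>] _ closed_off]) auto
  then have "closed ({0..1} \<inter> \<gamma> -` \<Gamma>')" by (rule closedin_closed_trans) simp
  then have "open (- ({0..1} \<inter> \<gamma> -` \<Gamma>'))" by (rule open_Compl)
  moreover have "s \<in> - ({0..1} \<inter> \<gamma> -` \<Gamma>')" using s by simp
  ultimately obtain \<epsilon> where "0 < \<epsilon>" "ball s \<epsilon> \<subseteq> - ({0..1} \<inter> \<gamma> -` \<Gamma>')"
    by (meson openE)
  then show ?thesis by (intro exI[of _ \<epsilon>]) (auto simp: dist_real_def abs_minus_commute subset_iff)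
qed

lemma continuous_along_arc:
  assumes "\<gamma> \<in> E" "continuous_on (network_space E) u"
  shows "continuous_on {0..1} (\<lambda>t. u (\<gamma> t))"
  using arc_in_network_space[OF assms(1)]
  by (intro continuous_on_compose2[OF assms(2) arc_continuous[OF net assms(1)]]) auto

lemma subsolution_increment_le:
  assumes "\<gamma> \<in> E" "primitive_on_unit G (slope_max (H \<gamma>) c)" "0 \<le> s" "s \<le> t" "t \<le> 1"
  shows "w (\<gamma> t) - w (\<gamma> s) \<le> G t - G s"
proof -
  have cont: "continuous_on {0..1} (w \<circ> \<gamma>)"
    using continuous_along_arc[OF assms(1), of w] sub by (simp add: subsolution_def o_def)
  have "\<forall>s\<in>{0<..<1}. visc_sub_at (H \<gamma>) c (w \<circ> \<gamma>) s"
    using sub assms(1) by (simp add: subsolution_def)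
  from visc_sub_increment_le[OF adm[OF assms(1)] cont this assms(2-)] show ?thesis by simp
qed

text \<open>The lower increment bound is the upper one along the reversed arc.\<close>

lemma arc_contact_along_arc:
  assumes \<gamma>: "\<gamma> \<in> E"
    and Gp: "primitive_on_unit Gp (slope_max (H \<gamma>) c)"
    and Gm: "primitive_on_unit Gm (slope_min (H \<gamma>) c)"
  shows "arc_contact (H \<gamma>) c (\<lambda>t. w (\<gamma> t) - M) (\<lambda>t. v (\<gamma> t)) Gp Gm"
proof
  show "continuous_on {0..1} (\<lambda>t. w (\<gamma> t) - M)"
    using sub by (intro continuous_intros continuous_along_arc[OF \<gamma>]) (simp add: subsolution_def)
  show "continuous_on {0..1} (\<lambda>t. v (\<gamma> t))"
    using super by (intro continuous_along_arc[OF \<gamma>]) (simp add: supersolution_in_def)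
  show "w (\<gamma> t) - M \<le> v (\<gamma> t)" if "t \<in> {0..1}" for t
    using below arc_in_network_space[OF \<gamma> that] by blast
  show "w (\<gamma> t) - M - (w (\<gamma> s) - M) \<le> Gp t - Gp s" if "0 \<le> s" "s \<le> t" "t \<le> 1" for s t
    using subsolution_increment_le[OF \<gamma> Gp that] by simp
  show "Gm t - Gm s \<le> w (\<gamma> t) - M - (w (\<gamma> s) - M)" if "0 \<le> s" "s \<le> t" "t \<le> 1" for s t
  proof -
    have "primitive_on_unit (\<lambda>t. Gm (1 - t)) (slope_max (H (reversepath \<gamma>)) c)"
      by (rule primitive_on_unit_reflect[OF Gm]) (rule slope_max_reversepath[OF ham \<gamma>])
    from subsolution_increment_le[OF embedded_networkD(3)[OF net \<gamma>] this, of "1 - t" "1 - s"] that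
    show ?thesis by (simp add: reversepath_def)
  qed
  fix s :: real assume s: "s \<in> {0..1}" "w (\<gamma> s) - M = v (\<gamma> s)"
  then have "\<gamma> s \<notin> \<Gamma>'"
    using arc_in_network_space[OF \<gamma>] by (intro contact_not_in) (simp add: contact_def)
  from off_neighbourhood[OF \<gamma> s(1) this] obtain \<epsilon> where
    \<epsilon>: "0 < \<epsilon>" "\<And>t. t \<in> {0..1} \<Longrightarrow> \<bar>t - s\<bar> < \<epsilon> \<Longrightarrow> \<gamma> t \<notin> \<Gamma>'" by blast
  have "visc_super_at (H \<gamma>) c (\<lambda>t. v (\<gamma> t)) t" if "t \<in> {0<..<1}" "\<gamma> t \<notin> \<Gamma>'" for t
  proof -
    have "\<gamma> t \<in> network_space E - \<Gamma>'" using that arc_in_network_space[OF \<gamma>, of t] by auto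
    then show ?thesis using super \<gamma> that unfolding supersolution_in_def o_def by blast
  qed
  then show "\<exists>\<epsilon>>0. \<forall>t\<in>{0..1}. \<bar>t - s\<bar> < \<epsilon> \<longrightarrow> slope_min (H \<gamma>) c t < slope_max (H \<gamma>) c t \<and>
      (0 < t \<and> t < 1 \<longrightarrow> visc_super_at (H \<gamma>) c (\<lambda>t. v (\<gamma> t)) t)"
    using \<epsilon> slopes_differ[OF \<gamma>] by (intro exI[of _ \<epsilon>]) auto
qed (use adm[OF \<gamma>] Gp Gm in auto)

lemma primitives_exist:
  assumes "\<gamma> \<in> E"
  obtains Gp Gm where "primitive_on_unit Gp (slope_max (H \<gamma>) c)"
    "primitive_on_unit Gm (slope_min (H \<gamma>) c)"
  using primitive_on_unit_exists[OF continuous_on_slope_max[OF adm[OF assms]]]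
    primitive_on_unit_exists[OF continuous_on_slope_min[OF adm[OF assms]]] that by blast

lemma contact_reaches_vertex:
  assumes "x \<in> contact"
  shows "\<exists>y \<in> vertices E. y \<in> contact"
proof -
  have "x \<in> network_space E" using assms by (simp add: contact_def)
  then show ?thesis
  proof (cases rule: network_space_cases)
    case 1
    then show ?thesis using assms by blast
  next
    case (2 \<gamma> s)
    then have s: "0 < s" "s < 1" "w (\<gamma> s) - M = v (\<gamma> s)" using assms by (auto simp: contact_def)
    have ends: "\<gamma> 0 \<in> vertices E" "\<gamma> 1 \<in> vertices E"
      "\<gamma> 0 \<in> network_space E" "\<gamma> 1 \<in> network_space E"
      using 2(1) arc_in_network_space[OF 2(1)]
      by (auto simp: vertices_def pathstart_def pathfinish_def)
    obtain Gp Gm where G: "primitive_on_unit Gp (slope_max (H \<gamma>) c)"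
        "primitive_on_unit Gm (slope_min (H \<gamma>) c)"
      by (rule primitives_exist[OF 2(1)])
    interpret A: arc_contact "H \<gamma>" c "\<lambda>t. w (\<gamma> t) - M" "\<lambda>t. v (\<gamma> t)" Gp Gm
      by (rule arc_contact_along_arc[OF 2(1) G])
    from s show ?thesis
    proof (cases rule: A.interior_contact_dichotomy)
      case (1 \<delta>)
      have "w (\<gamma> 0) - M = v (\<gamma> 0)" using A.contact_backward[OF _ 1(1,2,4), of 0] s by simp
      then show ?thesis using ends by (auto simp: contact_def)
    next
      case fwd: (2 \<delta>)
      let ?\<gamma> = "reversepath \<gamma>"
      have rev: "?\<gamma> \<in> E" by (rule embedded_networkD(3)[OF net 2(1)])
      have "primitive_on_unit (\<lambda>t. Gm (1 - t)) (slope_max (H ?\<gamma>) c)"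
        by (rule primitive_on_unit_reflect[OF G(2)]) (rule slope_max_reversepath[OF ham 2(1)])
      moreover have "primitive_on_unit (\<lambda>t. Gp (1 - t)) (slope_min (H ?\<gamma>) c)"
        by (rule primitive_on_unit_reflect[OF G(1)]) (rule slope_min_reversepath[OF 2(1)])
      ultimately interpret B: arc_contact "H ?\<gamma>" c "\<lambda>t. w (?\<gamma> t) - M" "\<lambda>t. v (?\<gamma> t)"
          "\<lambda>t. Gm (1 - t)" "\<lambda>t. Gp (1 - t)"
        by (rule arc_contact_along_arc[OF rev])
      have start: "w (?\<gamma> t) - M = v (?\<gamma> t) \<and>
          w (?\<gamma> (1 - s)) - M - (w (?\<gamma> t) - M) = Gm (1 - (1 - s)) - Gm (1 - t)"
        if "t \<in> {1 - s - \<delta>..1 - s}" for t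
      proof -
        have "1 - t \<in> {s..s + \<delta>}" using that by auto
        then have "w (\<gamma> (1 - t)) - M = v (\<gamma> (1 - t)) \<and>
            w (\<gamma> (1 - t)) - M - (w (\<gamma> s) - M) = Gm (1 - t) - Gm s" using fwd(4) by blast
        then show ?thesis by (simp add: reversepath_def)
      qed
      have "1 - s \<le> 1" "\<delta> \<le> 1 - s" "0 \<le> 1 - s" using s fwd(3) by auto
      from B.contact_backward[OF this(1) fwd(1) this(2) ballI[OF start] order_refl this(3)]
      have "w (?\<gamma> 0) - M = v (?\<gamma> 0)" by blast
      then have "w (\<gamma> 1) - M = v (\<gamma> 1)" by (simp add: reversepath_def)
      then show ?thesis using ends by (auto simp: contact_def)
    qed
  qed
qed

text \<open>The vertex condition of the supersolution selects an arc into a contact vertex that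
  consists of contact points and along which \<open>w\<close> has the maximal slope.\<close>

lemma contact_vertex_arc:
  assumes x: "x \<in> vertices E" "x \<in> contact"
  shows "\<exists>\<gamma>\<in>E. \<gamma> 1 = x \<and> \<gamma> ` {0..1} \<subseteq> contact \<and>
    (\<forall>t\<in>{0<..<1}. ((\<lambda>t. w (\<gamma> t)) has_real_derivative slope_max (H \<gamma>) c t) (at t))"
proof -
  have "x \<in> vertices E \<inter> (network_space E - \<Gamma>')"
    using x contact_not_in by (auto simp: contact_def)
  then have "\<exists>\<gamma>\<in>arcs_into E x. visc_super_at (H \<gamma>) c (v \<circ> \<gamma>) 1"
    using super unfolding supersolution_in_def by blast
  then obtain \<gamma> where \<gamma>: "\<gamma> \<in> E" "\<gamma> 1 = x" "visc_super_at (H \<gamma>) c (\<lambda>t. v (\<gamma> t)) 1"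
    by (auto simp: arcs_into_def pathfinish_def o_def)
  obtain Gp Gm where G: "primitive_on_unit Gp (slope_max (H \<gamma>) c)"
      "primitive_on_unit Gm (slope_min (H \<gamma>) c)"
    by (rule primitives_exist[OF \<gamma>(1)])
  interpret A: arc_contact "H \<gamma>" c "\<lambda>t. w (\<gamma> t) - M" "\<lambda>t. v (\<gamma> t)" Gp Gm
    by (rule arc_contact_along_arc[OF \<gamma>(1) G])
  have "w (\<gamma> 1) - M = v (\<gamma> 1)" using x \<gamma>(2) by (simp add: contact_def)
  from this \<gamma>(3) obtain \<delta> where \<delta>: "0 < \<delta>" "\<delta> \<le> 1"
    "\<forall>t\<in>{1 - \<delta>..1}. w (\<gamma> t) - M = v (\<gamma> t) \<and>
      w (\<gamma> 1) - M - (w (\<gamma> t) - M) = Gp 1 - Gp t"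
    by (rule A.endpoint_contact_step)
  have all: "w (\<gamma> t) - M = v (\<gamma> t) \<and> w (\<gamma> 1) - M - (w (\<gamma> t) - M) = Gp 1 - Gp t"
    if "t \<in> {0..1}" for t
    using A.contact_backward[OF order_refl \<delta>, of t] that by simp
  have "\<gamma> ` {0..1} \<subseteq> contact"
    using all arc_in_network_space[OF \<gamma>(1)] by (auto simp: contact_def)
  moreover have "((\<lambda>t. w (\<gamma> t)) has_real_derivative slope_max (H \<gamma>) c t) (at t)"
    if t: "t \<in> {0<..<1}" for t
  proof -
    have "((\<lambda>t. Gp t + (w (\<gamma> 1) - Gp 1)) has_real_derivative slope_max (H \<gamma>) c t) (at t)"
      using G(1) t by (auto intro!: derivative_eq_intros simp: primitive_on_unit_def)
    then show ?thesis
    proof (rule has_field_derivative_transform_within_open[where S = "{0<..<1}"])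
      fix y :: real assume "y \<in> {0<..<1}"
      then show "Gp y + (w (\<gamma> 1) - Gp 1) = w (\<gamma> y)" using all[of y] by simp
    qed (use t in auto)
  qed
  ultimately show ?thesis using \<gamma> by blast
qed

end

text \<open>The least period that occurs in the set makes the orbit injective.\<close>

lemma periodic_orbit_in_finite_set:
  fixes f :: "'b \<Rightarrow> 'b"
  assumes "finite A" "x \<in> A" "\<And>y. y \<in> A \<Longrightarrow> f y \<in> A"
  obtains y k where "y \<in> A" "0 < k" "(f ^^ k) y = y" "inj_on (\<lambda>i. (f ^^ i) y) {..<k}"
proof -
  have orbit: "(f ^^ n) x \<in> A" for n using assms(2,3) by (induction n) auto
  have "\<not> inj (\<lambda>n. (f ^^ n) x)"
    using finite_imageD[of "\<lambda>n. (f ^^ n) x" UNIV] finite_subset[OF _ assms(1)] orbit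
    by (metis image_subsetI infinite_UNIV_nat)
  then obtain m n where "m < n" "(f ^^ m) x = (f ^^ n) x"
    unfolding inj_def by (metis linorder_neqE_nat)
  then have "(f ^^ (n - m)) ((f ^^ m) x) = (f ^^ m) x"
    by (metis funpow_add le_add_diff_inverse2 less_imp_le o_apply)
  then have ex: "\<exists>k. 0 < k \<and> (\<exists>y\<in>A. (f ^^ k) y = y)"
    using \<open>m < n\<close> orbit by (intro exI[of _ "n - m"]) auto
  define k where "k = (LEAST k. 0 < k \<and> (\<exists>y\<in>A. (f ^^ k) y = y))"
  obtain y where k: "0 < k" and y: "y \<in> A" "(f ^^ k) y = y"
    using LeastI_ex[OF ex] unfolding k_def by blast
  have least: "k \<le> j" if "0 < j" "z \<in> A" "(f ^^ j) z = z" for j z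
    unfolding k_def using that by (intro Least_le) blast
  have orbit_y: "(f ^^ n) y \<in> A" for n using y(1) assms(3) by (induction n) auto
  have "inj_on (\<lambda>i. (f ^^ i) y) {..<k}"
  proof (rule linorder_inj_onI')
    fix i j assume ij: "i \<in> {..<k}" "j \<in> {..<k}" "i < j"
    show "(f ^^ i) y \<noteq> (f ^^ j) y"
    proof
      assume "(f ^^ i) y = (f ^^ j) y"
      then have "(f ^^ (j - i)) ((f ^^ i) y) = (f ^^ i) y"
        using ij by (metis funpow_add le_add_diff_inverse2 less_imp_le o_apply)
      then have "k \<le> j - i" using ij by (intro least[OF _ orbit_y]) auto
      then show False using ij by auto
    qed
  qed
  then show ?thesis using that y k by blast
qed

context network_contact
begin

text \<open>Following arcs backward from one contact vertex to the next produces a closed chain inside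
  the contact set; it has length zero and so lies in the Aubry set, which the contact set avoids.\<close>

lemma contact_empty: "contact = {}"
proof (rule ccontr)
  assume "contact \<noteq> {}"
  then obtain x0 where x0: "x0 \<in> vertices E \<inter> contact" using contact_reaches_vertex by blast
  have "\<forall>x\<in>vertices E \<inter> contact. \<exists>\<gamma>. \<gamma> \<in> E \<and> \<gamma> 1 = x \<and> \<gamma> ` {0..1} \<subseteq> contact \<and>
      (\<forall>t\<in>{0<..<1}. ((\<lambda>t. w (\<gamma> t)) has_real_derivative slope_max (H \<gamma>) c t) (at t))"
    using contact_vertex_arc by blast
  then obtain p where p: "\<forall>x\<in>vertices E \<inter> contact. p x \<in> E \<and> p x 1 = x \<and>
      p x ` {0..1} \<subseteq> contact \<and>
      (\<forall>t\<in>{0<..<1}. ((\<lambda>t. w (p x t)) has_real_derivative slope_max (H (p x)) c t) (at t))"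
    by (rule bchoice[THEN exE])
  define f where "f x = p x 0" for x
  have f: "f x \<in> vertices E \<inter> contact" if "x \<in> vertices E \<inter> contact" for x
  proof -
    have "p x \<in> E" "p x ` {0..1} \<subseteq> contact" using p that by blast+
    moreover have "p x 0 \<in> p x ` {0..1}" by simp
    ultimately show ?thesis by (auto simp: f_def vertices_def pathstart_def)
  qed
  have "finite (vertices E \<inter> contact)" using vertices_finite[OF net] by simp
  from this x0 f obtain y k where y: "y \<in> vertices E \<inter> contact" and k: "0 < k"
      and period: "(f ^^ k) y = y" and inj: "inj_on (\<lambda>i. (f ^^ i) y) {..<k}"
    by (rule periodic_orbit_in_finite_set)
  have z: "(f ^^ n) y \<in> vertices E \<inter> contact" for n using y f by (induction n) auto
  \<comment> \<open>The orbit of \<open>f\<close> runs against the orientation of the arcs, so it is traversed in reverse.\<close>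
  define \<eta> where "\<eta> i = p ((f ^^ (k - 1 - i)) y)" for i
  have \<eta>: "\<eta> i \<in> E" "\<eta> i 1 = (f ^^ (k - 1 - i)) y" "\<eta> i ` {0..1} \<subseteq> contact"
      "t \<in> {0<..<1} \<Longrightarrow> ((\<lambda>t. w (\<eta> i t)) has_real_derivative slope_max (H (\<eta> i)) c t) (at t)"
    for i t using p z unfolding \<eta>_def by blast+
  have start: "\<eta> i 0 = (f ^^ (k - i)) y" if "i < k" for i
  proof -
    have "\<eta> i 0 = (f ^^ Suc (k - 1 - i)) y" by (simp add: \<eta>_def f_def)
    moreover have "Suc (k - 1 - i) = k - i" using that by simp
    ultimately show ?thesis by metis
  qed
  interpret C: closed_chain E \<eta> k
  proof
    show "\<eta> i 1 = \<eta> (Suc i) 0" if "Suc i < k" for i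
      using \<eta>(2)[of i] start[OF that] by simp
    show "\<eta> (k - 1) 1 = \<eta> 0 0" using \<eta>(2)[of "k - 1"] start[OF k] period by simp
    show "inj_on (\<lambda>i. \<eta> i 0) {..<k}"
    proof (rule inj_onI)
      fix i j assume ij: "i \<in> {..<k}" "j \<in> {..<k}" "\<eta> i 0 = \<eta> j 0"
      \<comment> \<open>The start of \<open>\<eta> 0\<close> is the iterate of order \<open>k\<close>, which equals the one of order 0.\<close>
      define m where "m i = (if i = 0 then 0 else k - i)" for i
      have "(f ^^ m i) y = (f ^^ m j) y"
        using ij start period by (auto simp: m_def)
      moreover have "m i \<in> {..<k}" "m j \<in> {..<k}" using k by (auto simp: m_def)
      ultimately have "m i = m j" using inj by (auto dest: inj_onD)
      then show "i = j" using ij by (auto simp: m_def split: if_splits)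
    qed
    show "\<eta> i \<noteq> reversepath (\<eta> j)" for i j
    proof
      assume eq: "\<eta> i = reversepath (\<eta> j)"
      \<comment> \<open>The derivative of \<open>w\<close> at the common midpoint would make both extremal slopes equal.\<close>
      have half: "(1/2::real) \<in> {0<..<1}" "(1/2::real) \<in> {0..1}" by auto
      have "((\<lambda>t. 1 - t) has_real_derivative - 1) (at (1/2::real))"
        by (auto intro!: derivative_eq_intros)
      moreover have "((\<lambda>t. w (\<eta> j t)) has_real_derivative slope_max (H (\<eta> j)) c (1/2))
          (at (1 - 1/2))" using \<eta>(4)[OF half(1), of j] by simp
      ultimately have "((\<lambda>t. w (\<eta> j (1 - t))) has_real_derivative
          slope_max (H (\<eta> j)) c (1/2) * - 1) (at (1/2))" by (rule DERIV_chain2[rotated])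
      moreover have "((\<lambda>t. w (\<eta> j (1 - t))) has_real_derivative slope_max (H (\<eta> i)) c (1/2))
          (at (1/2))" using \<eta>(4)[OF half(1), of i] unfolding eq reversepath_def .
      ultimately have "slope_max (H (\<eta> i)) c (1/2) = - slope_max (H (\<eta> j)) c (1/2)"
        using DERIV_unique by fastforce
      moreover have "slope_max (H (\<eta> i)) c (1/2) = - slope_min (H (\<eta> j)) c (1/2)"
        using slope_max_reversepath[OF ham \<eta>(1) half(2), of j] unfolding eq by simp
      moreover have "\<eta> j (1/2) \<notin> \<Gamma>'" using \<eta>(3)[of j] half(2) contact_not_in by blast
      ultimately show False using slopes_differ[OF \<eta>(1) half(2)] by fastforce
    qed
  qed (use net k \<eta>(1) in auto)
  have "continuous_on (network_space E) w" using sub by (simp add: subsolution_def)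
  note int = C.curve_integral_zero[OF ham adm[OF \<eta>(1)] this \<eta>(4)]
  have mem: "C.\<xi> 0 \<in> C.\<xi> ` {0..real k}" by simp
  have "C.\<xi> 0 \<in> aubry_set E H"
    unfolding aubry_set_def using C.closed_simple_chain_curve mem int by blast
  then have "C.\<xi> 0 \<in> \<Gamma>'" using aubry by blast
  moreover have "C.\<xi> 0 \<in> contact"
    using mem \<eta>(3) unfolding C.curve_image by blast
  ultimately show False using contact_not_in by blast
qed

end

section \<open>The comparison theorem\<close>

theorem theorem5p3:
  fixes E :: "(real \<Rightarrow> 'a::euclidean_space) set"
    and H :: "(real \<Rightarrow> 'a) \<Rightarrow> real \<Rightarrow> real \<Rightarrow> real"
    and \<Gamma>' :: "'a set"
    and v w :: "'a \<Rightarrow> real"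
  assumes "embedded_network E"
    and "network_hamiltonian E H"
    and "closedin (top_of_set (network_space E)) \<Gamma>'"
    and "aubry_set E H \<subseteq> \<Gamma>'"
    and "supersolution_in E H (critical_value E H) (network_space E - \<Gamma>') v"
    and "subsolution E H (critical_value E H) w"
    and "\<forall>x\<in>\<Gamma>'. v x \<ge> w x"
  shows "\<forall>x\<in>network_space E. v x \<ge> w x"
proof (rule ccontr)
  assume "\<not> ?thesis"
  then obtain x where x: "x \<in> network_space E" "v x < w x" by auto
  have "continuous_on (network_space E) (\<lambda>x. w x - v x)"
    using assms(5,6) by (intro continuous_intros) (auto simp: supersolution_in_def subsolution_def)
  then obtain x0 where x0: "x0 \<in> network_space E"
      "\<forall>y\<in>network_space E. w y - v y \<le> w x0 - v x0"
    using continuous_attains_sup[OF network_space_compact[OF assms(1)]] x(1) by blast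
  define M where "M = w x0 - v x0"
  have M: "0 < M" using x x0(2) unfolding M_def by fastforce
  interpret N: network_contact E H \<Gamma>' v w M
  proof
    show "w y - M \<le> v y" if "y \<in> network_space E" for y
      using x0(2) that unfolding M_def by fastforce
    show "w y - M < v y" if "y \<in> \<Gamma>'" for y
      using assms(7) that M by fastforce
  qed (use assms in auto)
  have "x0 \<in> N.contact" using x0(1) unfolding N.contact_def by (simp add: M_def)
  then show False by (simp add: N.contact_empty)
qed

end
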